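(* For every integer $k\geq 3$ there exists an integer $N$ such that for every $n\geq N$ there exists a connected matroid $\mathsf{M}$ of rank $k$ and cardinality $n$ such that its base polytope $\mathscr{P}(\mathsf{M})$ is not Ehrhart positive.
   Context: For a matroid $\mathsf{M}$ on $E=\{1,\ldots,n\}$ with set of bases $\mathscr{B}$, the base polytope is $\mathscr{P}(\mathsf{M})=\operatorname{conv}\{e_B : B\in\mathscr{B}\}\subseteq\mathbb{R}^n$, where $e_B=\sum_{i\in B}e_i$ and $e_i$ is the $i$-th canonical basis vector. The cardinality of a matroid is the cardinality of its ground set. The Ehrhart polynomial of a lattice polytope $\mathscr{P}\subseteq\mathbb{R}^n$ is the polynomial $\operatorname{ehr}(\mathscr{P},t)$ of degree $\dim\mathscr{P}$ with $\operatorname{ehr}(\mathscr{P},t)=\#(t\mathscr{P}\cap\mathbb{Z}^n)$ for all nonnegative integers $t$. The polytope $\mathscr{P}$ is Ehrhart positive if all coefficients of $\operatorname{ehr}(\mathscr{P},t)$ (in degrees $0,\ldots,\dim\mathscr{P}$) are positive. A matroid is connected if for every pair of distinct elements of the ground set there is a circuit containing both. *)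

theory Defs
  imports
    "HOL-Analysis.Analysis"
    "HOL-Analysis.Finite_Function_Topology"
    "HOL-Computational_Algebra.Polynomial"
begin

locale matroid =
  fixes ground :: "'a set" and bases :: "'a set set"
  assumes finite_ground: "finite ground"
    and bases_subset: "B \<in> bases \<Longrightarrow> B \<subseteq> ground"
    and bases_nonempty: "bases \<noteq> {}"
    and basis_exchange:
      "\<lbrakk>A \<in> bases; B \<in> bases; a \<in> A - B\<rbrakk> \<Longrightarrow> \<exists>b\<in>B - A. insert b (A - {a}) \<in> bases"
begin

definition indep :: "'a set \<Rightarrow> bool" where
  "indep I \<longleftrightarrow> (\<exists>B\<in>bases. I \<subseteq> B)"

definition circuit :: "'a set \<Rightarrow> bool" where
  "circuit C \<longleftrightarrow> C \<subseteq> ground \<and> \<not> indep C \<and> (\<forall>D. D \<subset> C \<longrightarrow> indep D)"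

definition connected_matroid :: bool where
  "connected_matroid \<longleftrightarrow>
     (\<forall>x\<in>ground. \<forall>y\<in>ground. x \<noteq> y \<longrightarrow> (\<exists>C. circuit C \<and> x \<in> C \<and> y \<in> C))"

definition rank :: nat where
  "rank = (THE r. \<forall>B\<in>bases. card B = r)"

end

text \<open>
  As the dimension \<open>n\<close> has to vary inside a statement, \<open>\<real>\<^sup>n\<close> is represented by the vectors
  supported on the ground set \<open>{1..n}\<close> inside the real vector space \<^typ>\<open>nat \<Rightarrow>\<^sub>0 real\<close> of
  finitely supported sequences. A polytope contained in \<open>\<real>\<^sup>n\<close> and its dilations have the same
  lattice points and the same dimension in either space.
\<close>

definition indicator_vector :: "'a set \<Rightarrow> ('a \<Rightarrow>\<^sub>0 real)" where
  "indicator_vector B = (\<Sum>i\<in>B. Poly_Mapping.single i 1)"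

definition base_polytope :: "'a set set \<Rightarrow> ('a \<Rightarrow>\<^sub>0 real) set" where
  "base_polytope bases = convex hull (indicator_vector ` bases)"

definition integer_points :: "('a \<Rightarrow>\<^sub>0 real) set" where
  "integer_points = {x. \<forall>i. Poly_Mapping.lookup x i \<in> \<int>}"

text \<open>
  The library constant \<^const>\<open>aff_dim\<close> is restricted to Euclidean spaces, so the dimension of a
  nonempty \<open>P\<close> is taken as the linear dimension of the direction space of its affine hull.
\<close>

definition polytope_dim :: "('a \<Rightarrow>\<^sub>0 real) set \<Rightarrow> nat" where
  "polytope_dim P = dim {x - y | x y. x \<in> affine hull P \<and> y \<in> affine hull P}"

definition ehrhart_polynomial :: "('a \<Rightarrow>\<^sub>0 real) set \<Rightarrow> real poly" where
  "ehrhart_polynomial P =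
     (THE p. degree p = polytope_dim P \<and>
        (\<forall>t::nat. poly p (real t) = real (card ((*\<^sub>R) (real t) ` P \<inter> integer_points))))"

definition ehrhart_positive :: "('a \<Rightarrow>\<^sub>0 real) set \<Rightarrow> bool" where
  "ehrhart_positive P \<longleftrightarrow> (\<forall>i\<le>polytope_dim P. coeff (ehrhart_polynomial P) i > 0)"

end

theory Submission
  imports Defs "HOL-Number_Theory.Cong" "HOL-Real_Asymp.Real_Asymp"
begin

text \<open>
  Ferroni's argument. Take as nonbases a family \<open>\<H>\<close> of \<open>k\<close>-subsets of \<open>{1..n}\<close> pairwise meeting in at
  most \<open>k - 2\<close> elements (a sparse paving matroid). Its base polytope is the hypersimplex with one
  corner cut off for each \<open>H \<in> \<H>\<close>; the corners are disjoint and congruent, so the Ehrhart polynomial is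
  that of the hypersimplex minus \<open>card \<H>\<close> times that of a corner. The quadratic coefficient of
  the hypersimplex is \<open>O((log n)\<^sup>2)\<close> by Katzman's formula, that of a corner is at least
  \<open>1 / (k n)\<close>, and the Graham-Sloane construction gives a family with \<open>card \<H> \<ge> (n choose k) / n\<close>,
  which makes the difference negative for \<open>k \<ge> 3\<close> and large \<open>n\<close>.
\<close>

subsection \<open>Coefficient estimates\<close>

text \<open>The size of a corner dictates the choice of degree 2. The linear coefficient of one
  corner is only \<open>1 / ((n - k) * ((n - 1) choose (k - 1)))\<close>, so even a corner for every
  k-subset would remove just n / (k (n - k)), which stays bounded. In degree 2 the corners together
  remove at least (n choose k) / (k n^2), which is of order n^(k - 2) and so beats every multiple of
  (log n)^2 once k >= 3. Two obstacles shape the rest. The polytope is given as a convex hull,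
  whereas counting needs inequalities, so the system of inequalities has to be shown to cut out
  nothing beyond the hull of the bases. And \<open>ehrhart_polynomial\<close> is a definite
  description that demands the exact degree: a correct count does not yet identify it. Both the
  dimension and the degree are therefore shown to be n - 1, the degree by a crude lower bound on the
  number of lattice points instead of a leading coefficient.\<close>

definition rising_poly :: "nat \<Rightarrow> real poly" where
  "rising_poly m = (\<Prod>i<m. [:real i, 1:])"

lemma poly_rising_poly: "poly (rising_poly m) x = pochhammer x m"
  by (simp add: rising_poly_def poly_prod pochhammer_prod atLeast0LessThan add.commute)

lemma coeff_mult_nonneg:
  fixes p q :: "real poly"
  assumes "\<And>i. coeff p i \<ge> 0" "\<And>i. coeff q i \<ge> 0"
  shows "coeff (p * q) i \<ge> 0"
  using assms by (auto simp: coeff_mult intro!: sum_nonneg)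

lemma coeff_rising_poly_nonneg: "coeff (rising_poly m) i \<ge> 0"
proof (induction m arbitrary: i)
  case 0
  then show ?case by (simp add: rising_poly_def)
next
  case (Suc m)
  have "rising_poly (Suc m) = rising_poly m * [:real m, 1:]"
    by (simp add: rising_poly_def)
  moreover have "coeff [:real m, 1:] i \<ge> 0" for i
    by (auto simp: coeff_pCons split: nat.splits)
  ultimately show ?case
    by (simp only: coeff_mult_nonneg[OF Suc.IH])
qed

lemma coeff_1_rising_poly:
  assumes "m > 0"
  shows "coeff (rising_poly m) 1 = fact (m - 1)"
proof -
  obtain l where m: "m = Suc l" using assms by (cases m) auto
  have "rising_poly (Suc l) = [:0, 1:] * (\<Prod>i<l. [:real (Suc i), 1:])"
    unfolding rising_poly_def by (subst prod.lessThan_Suc_shift) (simp add: o_def)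
  hence "coeff (rising_poly (Suc l)) 1 = coeff (\<Prod>i<l. [:real (Suc i), 1:]) 0"
    by (simp add: coeff_pCons)
  also have "\<dots> = (\<Prod>i<l. real (Suc i))"
    by (simp add: poly_0_coeff_0[symmetric] poly_prod)
  also have "\<dots> = fact l"
    by (simp add: fact_prod_Suc atLeast0LessThan)
  finally show ?thesis by (simp add: m)
qed

text \<open>Ferroni's formula for the Ehrhart polynomial of a minimal matroid, shifted by one; here
  \<open>\<kappa> = k - 1\<close> and \<open>\<mu> = n - k - 1\<close>.\<close>

definition corner_poly :: "nat \<Rightarrow> nat \<Rightarrow> real poly" where
  "corner_poly \<kappa> \<mu> = smult (1 / real ((\<mu> + \<kappa> + 1) choose \<kappa>))
     (\<Sum>j\<le>\<kappa>. smult (real ((\<mu> + j) choose j) / (fact (Suc \<mu>) * fact j))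
        (rising_poly (Suc \<mu>) * rising_poly j))"

text \<open>This makes the sum over s in \<open>poly_corner_poly\<close> telescope. In the induction
  the new summand combines with the old difference because the two binomial coefficients are
  proportional by absorption and add up by Pascal's rule.\<close>

lemma corner_sum_difference:
  fixes x :: real and \<mu> :: nat
  defines "f \<equiv> \<lambda>a x. pochhammer x a / fact a"
  defines "G \<equiv> \<lambda>\<kappa> x. (\<Sum>j\<le>\<kappa>. real ((\<mu> + j) choose j) * (f (Suc \<mu>) x * f j x))"
  shows "G \<kappa> (x + 1) - G \<kappa> x = real ((\<mu> + \<kappa> + 1) choose \<kappa>) * (f \<kappa> (x + 1) * f \<mu> (x + 1))"
proof -
  \<comment> \<open>Both arguments are reduced to x + 1, so that in the induction every term becomes
    a multiple of f \<kappa> (x + 1) times f \<mu> (x + 1).\<close>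
  have f1: "f (Suc a) x = x * f a (x + 1) / (real a + 1)" for a
    by (simp add: f_def pochhammer_rec[of x] add.commute)
  have f2: "f (Suc a) (x + 1) = f a (x + 1) * (x + 1 + real a) / (real a + 1)" for a
    unfolding f_def pochhammer_Suc by (simp add: add_ac mult_ac)
  show ?thesis
  proof (induction \<kappa>)
    case 0
    have nz: "real \<mu> + 1 \<noteq> 0" by linarith
    have "f (Suc \<mu>) (x + 1) - f (Suc \<mu>) x = f \<mu> (x + 1) * ((x + 1 + \<mu>) / (real \<mu> + 1) - x / (real \<mu> + 1))"
      unfolding f1 f2 by (simp add: algebra_simps)
    also have "(x + 1 + \<mu>) / (real \<mu> + 1) - x / (real \<mu> + 1) = 1"
      using nz by (simp add: diff_divide_distrib[symmetric])
    finally show ?case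
      by (simp add: G_def f_def)
  next
    case (Suc \<kappa>)
    define A where "A = f \<mu> (x + 1)"
    define B where "B = f \<kappa> (x + 1)"
    define c where "c = real ((\<mu> + \<kappa> + 1) choose \<kappa>)"
    define c1 where "c1 = real ((\<mu> + \<kappa> + 1) choose (Suc \<kappa>))"
    \<comment> \<open>Absorption relates the old and the new binomial coefficient. After eliminating
      \<open>c\<close> only an identity of rational functions in x remains.\<close>
    have "(Suc \<kappa>) * ((\<mu> + \<kappa> + 1) choose (Suc \<kappa>)) = (\<mu> + 1) * ((\<mu> + \<kappa> + 1) choose \<kappa>)"
      using binomial_absorb_comp[of "\<mu> + \<kappa> + 1" \<kappa>] binomial_absorption[of \<kappa> "\<mu> + \<kappa> + 1"]
      by (simp del: binomial_Suc_Suc)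
    hence "real ((Suc \<kappa>) * ((\<mu> + \<kappa> + 1) choose (Suc \<kappa>))) = real ((\<mu> + 1) * ((\<mu> + \<kappa> + 1) choose \<kappa>))"
      by (rule arg_cong)
    hence abs: "c1 * (real \<kappa> + 1) = c * (real \<mu> + 1)"
      by (simp add: c_def c1_def algebra_simps)
    have step: "G (Suc \<kappa>) y = G \<kappa> y + c1 * (f (Suc \<mu>) y * f (Suc \<kappa>) y)" for y
      by (simp add: G_def c1_def)
    have "G (Suc \<kappa>) (x + 1) - G (Suc \<kappa>) x
       = c * (B * A) + c1 * (A * (x + 1 + \<mu>) / (real \<mu> + 1) * (B * (x + 1 + \<kappa>) / (real \<kappa> + 1)) -
            x * A / (real \<mu> + 1) * (x * B / (real \<kappa> + 1)))"
      using Suc.IH unfolding step f1 f2 by (simp add: A_def B_def c_def algebra_simps)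
    also have "\<dots> = (c + c1) * (B * (x + 1 + \<kappa>) / (real \<kappa> + 1) * A)"
    proof -
      have c: "c = c1 * (real \<kappa> + 1) / (real \<mu> + 1)"
        using abs by (simp add: field_simps)
      have nz: "real \<mu> + 1 \<noteq> 0" "real \<kappa> + 1 \<noteq> 0" by linarith+
      show ?thesis unfolding c using nz by (simp add: divide_simps) algebra
    qed
    also have "c + c1 = real ((\<mu> + Suc \<kappa> + 1) choose (Suc \<kappa>))"
      by (simp add: c_def c1_def)
    finally show ?case by (simp add: f2 A_def B_def)
  qed
qed

lemma pochhammer_Suc_eq_binomial:
  "pochhammer (real s + 1) a / fact a = real ((s + a) choose a)"
proof -
  have "real ((s + a) choose a) = (real (s + a)) gchoose a"
    by (simp add: binomial_gbinomial)
  also have "\<dots> = pochhammer (real s + 1) a / fact a"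
    by (subst gbinomial_pochhammer') (simp add: algebra_simps)
  finally show ?thesis ..
qed

text \<open>Telescoping of \<open>corner_sum_difference\<close>, started at t = 0, where the factor
  \<open>pochhammer x (Suc \<mu>)\<close> vanishes. The summand for s will count pairs of
  compositions of s into \<kappa> + 1 and \<mu> + 1 parts.\<close>

lemma poly_corner_poly:
  "poly (corner_poly \<kappa> \<mu>) (real t) = real (\<Sum>s<t. ((s + \<kappa>) choose \<kappa>) * ((s + \<mu>) choose \<mu>))"
proof -
  define G where "G = (\<lambda>x::real. (\<Sum>j\<le>\<kappa>. real ((\<mu> + j) choose j) *
     (pochhammer x (Suc \<mu>) / fact (Suc \<mu>) * (pochhammer x j / fact j))))"
  define c where "c = real ((\<mu> + \<kappa> + 1) choose \<kappa>)"
  have c: "c \<noteq> 0" unfolding c_def by simp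
  have G: "G (real t) = c * real (\<Sum>s<t. ((s + \<kappa>) choose \<kappa>) * ((s + \<mu>) choose \<mu>))"
  proof (induction t)
    case 0
    show ?case by (simp add: G_def pochhammer_0_left)
  next
    case (Suc t)
    have "G (real t + 1) - G (real t) = c * (real ((t + \<kappa>) choose \<kappa>) * real ((t + \<mu>) choose \<mu>))"
      using corner_sum_difference[where \<mu> = \<mu> and \<kappa> = \<kappa> and x = "real t"]
      by (simp only: G_def c_def pochhammer_Suc_eq_binomial)
    then show ?case using Suc.IH by (simp add: algebra_simps)
  qed
  have "poly (corner_poly \<kappa> \<mu>) (real t) = G (real t) / c"
    by (simp add: corner_poly_def G_def c_def poly_sum poly_rising_poly sum_distrib_left sum_divide_distrib
        mult_ac)
  thus ?thesis using G c by simp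
qed

lemma degree_corner_poly_le: "degree (corner_poly \<kappa> \<mu>) \<le> \<mu> + \<kappa> + 1"
proof -
  have d: "degree (rising_poly m) \<le> m" for m
    unfolding rising_poly_def by (rule order.trans[OF degree_prod_sum_le]) auto
  have "degree (rising_poly (Suc \<mu>) * rising_poly j) \<le> \<mu> + \<kappa> + 1" if "j \<le> \<kappa>" for j
    using degree_mult_le[of "rising_poly (Suc \<mu>)" "rising_poly j"] d[of "Suc \<mu>"] d[of j] that by linarith
  thus ?thesis unfolding corner_poly_def
    by (intro order.trans[OF degree_smult_le] degree_sum_le order.trans[OF degree_smult_le]) auto
qed

text \<open>All coefficients involved are nonnegative, so it suffices to keep the summand j =
  \<kappa> and in it the product of the two linear coefficients. With n as above, \<kappa> + \<mu> +
  1 is n - 1.\<close>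

lemma coeff_2_corner_poly_ge:
  assumes "\<kappa> > 0"
  shows "coeff (corner_poly \<kappa> \<mu>) 2 \<ge> 1 / (real \<kappa> * (real \<kappa> + real \<mu> + 1))"
proof -
  let ?q = "\<lambda>j. rising_poly (Suc \<mu>) * rising_poly j"
  let ?a = "\<lambda>j. real ((\<mu> + j) choose j) / (fact (Suc \<mu>) * fact j) * coeff (?q j) 2"
  define c where "c = real ((\<mu> + \<kappa> + 1) choose \<kappa>)"
  have c: "c > 0" unfolding c_def by simp
  have "(fact \<mu> * fact (\<kappa> - 1) :: real) = coeff (rising_poly (Suc \<mu>)) 1 * coeff (rising_poly \<kappa>) 1"
    using coeff_1_rising_poly[OF assms] coeff_1_rising_poly[of "Suc \<mu>"] by simp
  also have "\<dots> = (\<Sum>i\<in>{1}. coeff (rising_poly (Suc \<mu>)) i * coeff (rising_poly \<kappa>) (2 - i))"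
    by (simp add: numeral_2_eq_2)
  also have "\<dots> \<le> coeff (?q \<kappa>) 2"
    unfolding coeff_mult
    by (rule sum_mono2) (auto intro!: mult_nonneg_nonneg coeff_rising_poly_nonneg)
  finally have q: "fact \<mu> * fact (\<kappa> - 1) \<le> coeff (?q \<kappa>) 2" .
  have "1 / ((real \<mu> + 1) * real \<kappa>) = fact \<mu> * fact (\<kappa> - 1) / (fact (Suc \<mu>) * fact \<kappa>)"
    using assms by (simp add: fact_reduce[of \<kappa>])
  also have "\<dots> \<le> coeff (?q \<kappa>) 2 / (fact (Suc \<mu>) * fact \<kappa>)"
    by (rule divide_right_mono[OF q]) simp
  finally have q': "1 / ((real \<mu> + 1) * real \<kappa>) \<le> coeff (?q \<kappa>) 2 / (fact (Suc \<mu>) * fact \<kappa>)" .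
  \<comment> \<open>Absorption again: the binomial of the top summand over the normalising one is
    (\<mu> + 1) / (\<kappa> + \<mu> + 1), whose numerator cancels the \<mu> + 1 left over from the
    factorials.\<close>
  have "(\<mu> + 1) * ((\<mu> + \<kappa> + 1) choose \<kappa>) = (\<mu> + \<kappa> + 1) * ((\<mu> + \<kappa>) choose \<kappa>)"
    using binomial_absorb_comp[of "\<mu> + \<kappa> + 1" \<kappa>] by simp
  hence "real ((\<mu> + 1) * ((\<mu> + \<kappa> + 1) choose \<kappa>)) = real ((\<mu> + \<kappa> + 1) * ((\<mu> + \<kappa>) choose \<kappa>))"
    by (rule arg_cong)
  hence e: "real ((\<mu> + \<kappa>) choose \<kappa>) / c = (real \<mu> + 1) / (real \<kappa> + real \<mu> + 1)"
    using c by (simp add: c_def field_simps)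
  have "1 / (real \<kappa> * (real \<kappa> + real \<mu> + 1)) = real ((\<mu> + \<kappa>) choose \<kappa>) / c * (1 / ((real \<mu> + 1) * real \<kappa>))"
  proof -
    have "real \<mu> + 1 > 0" "real \<kappa> + real \<mu> + 1 > 0" by linarith+
    thus ?thesis unfolding e using assms by (simp add: divide_simps)
  qed
  also have "\<dots> \<le> real ((\<mu> + \<kappa>) choose \<kappa>) / c * (coeff (?q \<kappa>) 2 / (fact (Suc \<mu>) * fact \<kappa>))"
    using c by (intro mult_left_mono[OF q']) auto
  also have "\<dots> = (\<Sum>j\<in>{\<kappa>}. ?a j) / c"
    by simp
  also have "\<dots> \<le> (\<Sum>j\<le>\<kappa>. ?a j) / c"
    using c by (intro divide_right_mono sum_mono2)
      (auto intro!: mult_nonneg_nonneg divide_nonneg_nonneg coeff_mult_nonneg coeff_rising_poly_nonneg)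
  also have "\<dots> = coeff (corner_poly \<kappa> \<mu>) 2"
    by (simp add: corner_poly_def c_def coeff_sum)
  finally show ?thesis .
qed

section \<open>The quadratic coefficient of the hypersimplex\<close>

text \<open>The coefficient is the r-th elementary symmetric function of the \<open>d i\<close>, and
  each of its monomials occurs in the expansion of the r-th power on the right.\<close>

lemma abs_coeff_prod_linear_le:
  fixes d :: "'i \<Rightarrow> real"
  assumes "finite I"
  shows "\<bar>coeff (\<Prod>i\<in>I. [:1, d i:]) r\<bar> \<le> (\<Sum>i\<in>I. \<bar>d i\<bar>) ^ r"
  using assms
proof (induction I arbitrary: r rule: finite_induct)
  case empty
  show ?case by (cases r) (auto simp: coeff_1)
next
  case (insert x I)
  let ?S = "\<Sum>i\<in>I. \<bar>d i\<bar>" and ?p = "\<Prod>i\<in>I. [:1, d i:]"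
  have S: "?S \<ge> 0" by (simp add: sum_nonneg)
  show ?case
  proof (cases r)
    case 0
    then show ?thesis using insert by (simp add: poly_0_coeff_0[symmetric] poly_prod)
  next
    case (Suc q)
    have "\<bar>coeff (\<Prod>i\<in>insert x I. [:1, d i:]) r\<bar> = \<bar>coeff ?p (Suc q) + d x * coeff ?p q\<bar>"
      using insert Suc by (simp add: mult_pCons_left)
    also have "\<dots> \<le> \<bar>coeff ?p (Suc q)\<bar> + \<bar>d x\<bar> * \<bar>coeff ?p q\<bar>"
      by (metis abs_mult abs_triangle_ineq)
    also have "\<dots> \<le> ?S ^ Suc q + \<bar>d x\<bar> * ?S ^ q"
      by (intro add_mono mult_left_mono insert.IH) auto
    also have "\<dots> = (\<bar>d x\<bar> + ?S) * ?S ^ q"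
      by (simp add: algebra_simps)
    also have "\<dots> \<le> (\<bar>d x\<bar> + ?S) * (\<bar>d x\<bar> + ?S) ^ q"
      using S by (intro mult_left_mono power_mono) auto
    finally show ?thesis using insert Suc by simp
  qed
qed

text \<open>Normalises the constant terms to 1, the form required by
  \<open>abs_coeff_prod_linear_le\<close>.\<close>

lemma prod_linear_eq_smult:
  fixes c :: "'i \<Rightarrow> real"
  assumes "\<And>i. i \<in> I \<Longrightarrow> c i \<noteq> 0"
  shows "(\<Prod>i\<in>I. [:c i, a:]) = smult (\<Prod>i\<in>I. c i) (\<Prod>i\<in>I. [:1, a / c i:])"
proof -
  have "[:c i, a:] = smult (c i) [:1, a / c i:]" if "i \<in> I" for i
    using assms[OF that] by simp
  hence "(\<Prod>i\<in>I. [:c i, a:]) = (\<Prod>i\<in>I. smult (c i) [:1, a / c i:])"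
    by (rule prod.cong[OF refl])
  thus ?thesis by (simp only: prod_smult)
qed

text \<open>The \<open>j\<close>-th summand of Katzman's inclusion-exclusion formula for the hypersimplex.\<close>

definition katzman_term :: "nat \<Rightarrow> nat \<Rightarrow> nat \<Rightarrow> real poly" where
  "katzman_term n k j = smult ((-1) ^ j * real (n choose j) / fact (n - 1))
     (\<Prod>i<n - 1. [:real (n - 1 - j) - real i, real (k - j):])"

lemma poly_katzman_term:
  "poly (katzman_term n k j) (real t) =
     (-1) ^ j * real (n choose j) * real (((k - j) * t + (n - 1 - j)) choose (n - 1))"
proof -
  have "poly [:real (n - 1 - j) - real i, real (k - j):] (real t) = real ((k - j) * t + (n - 1 - j)) - real i" for i
    by (simp only: poly_pCons poly_0 of_nat_add of_nat_mult) simp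
  thus ?thesis
    by (simp only: katzman_term_def poly_smult poly_prod binomial_gbinomial gbinomial_prod_rev
        atLeast0LessThan) simp
qed

lemma degree_katzman_term_le: "degree (katzman_term n k j) \<le> n - 1"
proof -
  have "degree (\<Prod>i<n - 1. [:real (n - 1 - j) - real i, real (k - j):]) \<le> n - 1"
    by (rule order.trans[OF degree_prod_sum_le])
      (auto intro!: order.trans[OF sum_bounded_above[where K = 1]])
  thus ?thesis unfolding katzman_term_def
    by (rule order.trans[OF degree_smult_le])
qed

text \<open>For j = 0 no factor has constant term 0; the constant terms multiply to (n - 1)! and
  cancel, leaving the product of the 1 + k t / i. This summand is the source of the squared
  logarithm.\<close>

lemma abs_coeff_2_katzman_term_0_le:
  "\<bar>coeff (katzman_term n k 0) 2\<bar> \<le> (real k * harm n)\<^sup>2"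
proof -
  have e: "(\<Prod>i<n - 1. [:real (n - 1) - real i, real k:]) = (\<Prod>i=1..n-1. [:real i, real k:])"
    by (rule prod.reindex_bij_witness[of _ "\<lambda>i. n - 1 - i" "\<lambda>i. n - 1 - i"])
      (auto simp: of_nat_diff)
  have "katzman_term n k 0 = smult (1 / fact (n - 1)) (smult (\<Prod>i=1..n-1. real i) (\<Prod>i=1..n-1. [:1, real k / real i:]))"
    unfolding katzman_term_def using e by (subst prod_linear_eq_smult[symmetric]) auto
  also have "\<dots> = (\<Prod>i=1..n-1. [:1, real k / real i:])"
    by (simp add: fact_prod)
  finally have "\<bar>coeff (katzman_term n k 0) 2\<bar> \<le> (\<Sum>i=1..n-1. \<bar>real k / real i\<bar>)\<^sup>2"
    by (simp only: abs_coeff_prod_linear_le finite_atLeastAtMost)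
  also have "(\<Sum>i=1..n-1. \<bar>real k / real i\<bar>) = real k * harm (n - 1)"
    by (simp add: harm_def sum_distrib_left field_simps)
  also have "\<dots>\<^sup>2 \<le> (real k * harm n)\<^sup>2"
    by (intro power_mono mult_left_mono harm_mono mult_nonneg_nonneg) (auto intro: harm_nonneg)
  finally show ?thesis .
qed

text \<open>For j > 0 the factor with i = n - 1 - j is a multiple of t. Hence only the linear
  coefficient of the remaining product enters, which costs a single harmonic number. The scalar in
  front is n / (j (n - j)) times k - j, and n / (j (n - j)) is at most 2 since j < k and 2 k <=
  n.\<close>

lemma abs_coeff_2_katzman_term_le:
  assumes j: "0 < j" "j < k" and n: "2 * k \<le> n"
  shows "\<bar>coeff (katzman_term n k j) 2\<bar> \<le> 4 * (real k)\<^sup>2 * harm n"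
proof -
  define a where "a = real (k - j)"
  define N where "N = n - 1 - j"
  have N: "n - 1 = N + j" using j n by (simp add: N_def)

  \<comment> \<open>The index \<open>N\<close> of the factor without constant term is left out;
    below it the constant terms run through 1, ..., N, above it through -1, ..., -(j - 1).\<close>
  define I where "I = {..<N} \<union> {N+1..<N+j}"
  have fin: "finite I" by (simp add: I_def)
  define Q where "Q = (\<Prod>i\<in>I. [:1, a / (real N - real i):])"
  define C where "C = (\<Prod>i\<in>I. real N - real i)"
  have "{..<n - 1} = insert N I" "N \<notin> I" using N j by (auto simp: I_def)
  hence "(\<Prod>i<n - 1. [:real N - real i, a:]) = [:0, a:] * (\<Prod>i\<in>I. [:real N - real i, a:])"
    using fin by simp
  also have "(\<Prod>i\<in>I. [:real N - real i, a:]) = smult C Q"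
    unfolding C_def Q_def by (rule prod_linear_eq_smult) (auto simp: I_def)
  finally have K: "katzman_term n k j = smult ((-1) ^ j * real (n choose j) / fact (n - 1) * a * C) (pCons 0 Q)"
    by (simp add: katzman_term_def a_def N_def algebra_simps)
  have shift1: "(\<Prod>i<N. g (real N - real i)) = (\<Prod>i=1..N. g (real i))" for g :: "real \<Rightarrow> real"
    by (rule prod.reindex_bij_witness[of _ "\<lambda>i. N - i" "\<lambda>i. N - i"]) (auto simp: of_nat_diff)
  have shift2: "(\<Prod>i=N+1..<N+j. g (real N - real i)) = (\<Prod>i=1..j-1. g (- real i))" for g :: "real \<Rightarrow> real"
    by (rule prod.reindex_bij_witness[of _ "\<lambda>i. N + i" "\<lambda>i. i - N"]) (auto simp: of_nat_diff)
  have sshift1: "(\<Sum>i<N. g (real N - real i)) = (\<Sum>i=1..N. g (real i))" for g :: "real \<Rightarrow> real"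
    by (rule sum.reindex_bij_witness[of _ "\<lambda>i. N - i" "\<lambda>i. N - i"]) (auto simp: of_nat_diff)
  have sshift2: "(\<Sum>i=N+1..<N+j. g (real N - real i)) = (\<Sum>i=1..j-1. g (- real i))" for g :: "real \<Rightarrow> real"
    by (rule sum.reindex_bij_witness[of _ "\<lambda>i. N + i" "\<lambda>i. i - N"]) (auto simp: of_nat_diff)
  have "\<bar>C\<bar> = (\<Prod>i\<in>I. \<bar>real N - real i\<bar>)"
    by (simp add: C_def abs_prod)
  also have "\<dots> = (\<Prod>i<N. \<bar>real N - real i\<bar>) * (\<Prod>i=N+1..<N+j. \<bar>real N - real i\<bar>)"
    unfolding I_def by (rule prod.union_disjoint) auto
  also have "\<dots> = fact N * fact (j - 1)"
    using shift1[of abs] shift2[of abs] by (simp add: fact_prod)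
  finally have C: "\<bar>C\<bar> = fact N * fact (j - 1)" .
  have S: "(\<Sum>i\<in>I. \<bar>a / (real N - real i)\<bar>) \<le> 2 * a * harm n"
  proof -
    have "(\<Sum>i\<in>I. \<bar>a / (real N - real i)\<bar>) =
       (\<Sum>i<N. \<bar>a / (real N - real i)\<bar>) + (\<Sum>i=N+1..<N+j. \<bar>a / (real N - real i)\<bar>)"
      unfolding I_def by (rule sum.union_disjoint) auto
    also have "\<dots> = a * harm N + a * harm (j - 1)"
      using sshift1[of "\<lambda>x. \<bar>a / x\<bar>"] sshift2[of "\<lambda>x. \<bar>a / x\<bar>"]
      by (simp add: a_def harm_def sum_distrib_left field_simps)
    also have "\<dots> \<le> a * harm n + a * harm n"
    proof -
      have "N \<le> n" "j - 1 \<le> n" "a \<ge> 0" using N j n by (auto simp: a_def N_def)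
      thus ?thesis by (intro add_mono mult_left_mono harm_mono)
    qed
    finally show ?thesis by simp
  qed
  have Q: "\<bar>coeff Q 1\<bar> \<le> 2 * a * harm n"
    using abs_coeff_prod_linear_le[OF fin, of "\<lambda>i. a / (real N - real i)" 1] S by (simp add: Q_def)
  have "real (n choose j) = fact n / (fact j * fact (n - j))"
    using j n by (intro binomial_fact) auto
  also have "fact n = real n * fact (n - 1)" using j n by (simp add: fact_reduce)
  also have "fact j = real j * fact (j - 1)" using j by (simp add: fact_reduce)
  also have "fact (n - j) = real (n - j) * fact N"
  proof -
    have "n - j = Suc N" using j n by (simp add: N_def)
    thus ?thesis by simp
  qed
  finally have binom: "real (n choose j) =
      real n * fact (n - 1) / (real j * fact (j - 1) * (real (n - j) * fact N))" .
  have "real (n choose j) / fact (n - 1) * \<bar>C\<bar> = real n / (real j * real (n - j))"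
  proof -
    have "(x * f / (y * g * (z * h))) / f * (h * g) = x / (y * z)" if "f > 0" "g > 0" "h > 0"
      for x y z f g h :: real
      using that by (cases "y = 0"; cases "z = 0") (auto simp: field_simps)
    thus ?thesis unfolding C binom by simp
  qed
  also have "\<dots> \<le> 2"
  proof -
    have "n \<le> 2 * (j * (n - j))"
    proof -
      have "n \<le> 2 * (n - j)" using j n by linarith
      also have "\<dots> \<le> 2 * (j * (n - j))" using j by simp
      finally show ?thesis .
    qed
    hence "real n \<le> real (2 * (j * (n - j)))" by (subst of_nat_le_iff)
    moreover have "real j * real (n - j) > 0" using j n by simp
    ultimately show ?thesis by (subst divide_le_eq) (auto simp: )
  qed
  finally have B: "real (n choose j) / fact (n - 1) * \<bar>C\<bar> \<le> 2" .
  have "\<bar>coeff (katzman_term n k j) 2\<bar> = (real (n choose j) / fact (n - 1) * \<bar>C\<bar>) * (a * \<bar>coeff Q 1\<bar>)"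
    unfolding K by (simp add: coeff_pCons abs_mult a_def numeral_2_eq_2)
  also have "\<dots> \<le> 2 * (a * (2 * a * harm n))"
    using B Q by (intro mult_mono) (auto simp: a_def)
  also have "\<dots> = 4 * a\<^sup>2 * harm n"
    by (simp add: power2_eq_square)
  also have "\<dots> \<le> 4 * (real k)\<^sup>2 * harm n"
    by (intro mult_right_mono mult_left_mono power_mono harm_nonneg) (auto simp: a_def)
  finally show ?thesis .
qed

definition hypersimplex_poly :: "nat \<Rightarrow> nat \<Rightarrow> real poly" where
  "hypersimplex_poly n k = (\<Sum>j<k. katzman_term n k j)"

lemma coeff_2_hypersimplex_poly_le:
  assumes k: "0 < k" and n: "2 * k \<le> n"
  shows "coeff (hypersimplex_poly n k) 2 \<le> 5 * real k ^ 3 * (harm n)\<^sup>2"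
proof -
  have h: "harm n \<ge> (1::real)"
    using harm_mono[of 1 n, where 'a = real] k n by (simp add: harm_expand)
  \<comment> \<open>Since harm n >= 1, the bounds for j > 0, linear in harm n, are absorbed by the
    quadratic one for j = 0.\<close>
  have h2: "harm n \<le> (harm n :: real)\<^sup>2"
    using mult_right_mono[OF h, of "harm n"] harm_nonneg[of n, where 'a = real]
    by (simp add: power2_eq_square)
  have "coeff (katzman_term n k j) 2 \<le> 4 * (real k)\<^sup>2 * (harm n)\<^sup>2" if "j < k" for j
  proof (cases "j = 0")
    case True
    have "coeff (katzman_term n k j) 2 \<le> (real k * harm n)\<^sup>2"
      using abs_coeff_2_katzman_term_0_le[of n k] True by simp
    also have "\<dots> = 1 * ((real k)\<^sup>2 * (harm n)\<^sup>2)" by (simp add: power_mult_distrib)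
    also have "\<dots> \<le> 4 * ((real k)\<^sup>2 * (harm n)\<^sup>2)" by (intro mult_right_mono) auto
    finally show ?thesis by simp
  next
    case False
    have "coeff (katzman_term n k j) 2 \<le> 4 * (real k)\<^sup>2 * harm n"
      using abs_coeff_2_katzman_term_le[of j k n] False that n by simp
    also have "\<dots> \<le> 4 * (real k)\<^sup>2 * (harm n)\<^sup>2" by (intro mult_left_mono h2) auto
    finally show ?thesis .
  qed
  hence "coeff (hypersimplex_poly n k) 2 \<le> (\<Sum>j<k. 4 * (real k)\<^sup>2 * (harm n)\<^sup>2)"
    unfolding hypersimplex_poly_def coeff_sum by (intro sum_mono) auto
  also have "\<dots> \<le> 5 * real k ^ 3 * (harm n)\<^sup>2"
  proof -
    have "real k ^ 3 * (harm n)\<^sup>2 \<ge> 0" by simp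
    thus ?thesis by (simp add: power3_eq_cube power2_eq_square mult_ac)
  qed
  finally show ?thesis .
qed

lemma degree_hypersimplex_poly_le: "degree (hypersimplex_poly n k) \<le> n - 1"
  unfolding hypersimplex_poly_def by (intro degree_sum_le degree_katzman_term_le) auto

subsection \<open>Counting lattice points\<close>

text \<open>Requiring the value 0 outside \<open>E\<close> makes a function determined by its
  restriction to \<open>E\<close>, so cardinalities are meaningful. The set \<open>A\<close> of
  allowed parts is \<open>UNIV\<close> for the corners and \<open>{..t}\<close> for the
  hypersimplex.\<close>

definition compositions :: "nat set \<Rightarrow> 'a set \<Rightarrow> nat \<Rightarrow> ('a \<Rightarrow> nat) set" where
  "compositions A E s = {f. (\<forall>i. i \<notin> E \<longrightarrow> f i = 0) \<and> (\<forall>i\<in>E. f i \<in> A) \<and> sum f E = s}"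

lemma compositions_empty: "compositions A {} s = (if s = 0 then {\<lambda>_. 0} else {})"
  by (auto simp: compositions_def)

text \<open>Splitting off the value at \<open>e\<close> is the combinatorial form of one Cauchy
  product.\<close>

lemma compositions_insert:
  assumes "finite E" "e \<notin> E"
  shows "bij_betw (\<lambda>(a, f). f(e := a)) (SIGMA a:{0..s} \<inter> A. compositions A E (s - a))
           (compositions A (insert e E) s)"
proof (rule bij_betw_byWitness[where f' = "\<lambda>f. (f e, f(e := 0))"])
  have upd: "sum (f(e := a)) E = sum f E" for f :: "'a \<Rightarrow> nat" and a
    using assms(2) by (intro sum.cong) auto
  show "\<forall>x\<in>SIGMA a:{0..s} \<inter> A. compositions A E (s - a).
      (\<lambda>f. (f e, f(e := 0))) ((\<lambda>(a, f). f(e := a)) x) = x"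
    using assms by (auto simp: compositions_def fun_eq_iff)
  show "\<forall>f\<in>compositions A (insert e E) s. (\<lambda>(a, f). f(e := a)) (f e, f(e := 0)) = f"
    by simp
  show "(\<lambda>(a, f). f(e := a)) ` (SIGMA a:{0..s} \<inter> A. compositions A E (s - a))
      \<subseteq> compositions A (insert e E) s"
    using assms by (auto simp: compositions_def upd[unfolded fun_upd_def])
  show "(\<lambda>f. (f e, f(e := 0))) ` compositions A (insert e E) s
      \<subseteq> (SIGMA a:{0..s} \<inter> A. compositions A E (s - a))"
    using assms by (auto simp: compositions_def upd[unfolded fun_upd_def])
qed

text \<open>Every element of \<open>E\<close> contributes one factor, the indicator series of
  \<open>A\<close>.\<close>

lemma compositions_generating_function:
  assumes "finite E"
  shows "finite (compositions A E s) \<and>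
    real (card (compositions A E s)) = fps_nth (Abs_fps (\<lambda>j. of_bool (j \<in> A)) ^ card E) s"
  using assms
proof (induction E arbitrary: s rule: finite_induct)
  case empty
  show ?case by (simp add: compositions_empty)
next
  case (insert e E)
  let ?F = "Abs_fps (\<lambda>j. of_bool (j \<in> A)) :: real fps"
  let ?S = "SIGMA a:{0..s} \<inter> A. compositions A E (s - a)"
  note bij = compositions_insert[OF insert.hyps, of s A]
  have "finite ?S" using insert.IH by auto
  hence "finite (compositions A (insert e E) s)"
    using bij bij_betw_finite by blast
  have "real (card (compositions A (insert e E) s)) = real (card ?S)"
    using bij_betw_same_card[OF bij] by simp
  also have "\<dots> = (\<Sum>a\<in>{0..s} \<inter> A. real (card (compositions A E (s - a))))"
    using insert.IH by simp
  also have "\<dots> = (\<Sum>a=0..s. of_bool (a \<in> A) * fps_nth (?F ^ card E) (s - a))"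
    using insert.IH by (intro sum.mono_neutral_cong_left) auto
  also have "\<dots> = fps_nth (?F ^ card (insert e E)) s"
    using insert.hyps by (simp add: fps_mult_nth)
  finally show ?case using \<open>finite (compositions A (insert e E) s)\<close> by simp
qed

lemma finite_compositions: "finite E \<Longrightarrow> finite (compositions A E s)"
  using compositions_generating_function by blast

lemma geometric_fps_power_nth:
  assumes "n > 0"
  shows "fps_nth (Abs_fps (\<lambda>_. 1 :: real) ^ n) s = real ((s + (n - 1)) choose (n - 1))"
proof -
  have "Abs_fps (\<lambda>_. 1 :: real) ^ n = inverse ((1 - fps_const 1 * fps_X) ^ n)"
    by (simp add: fps_inverse_power fps_inverse_one_minus_fps_X)
  also have "\<dots> = Abs_fps (\<lambda>k. of_nat ((n + k - 1) choose k))"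
    using one_minus_const_fps_X_neg_power'[OF assms, of "1::real"] by simp
  finally have "fps_nth (Abs_fps (\<lambda>_. 1 :: real) ^ n) s = real ((n + s - 1) choose s)"
    by simp
  also have "(n + s - 1) choose s = (s + (n - 1)) choose (n - 1)"
    using assms binomial_symmetric[of s "n + s - 1"] by (simp add: algebra_simps)
  finally show ?thesis .
qed

lemma card_compositions_UNIV:
  assumes "finite E" "E \<noteq> {}"
  shows "card (compositions UNIV E s) = (s + (card E - 1)) choose (card E - 1)"
proof -
  have "card E > 0" using assms by (simp add: card_gt_0_iff)
  hence "real (card (compositions UNIV E s)) = real ((s + (card E - 1)) choose (card E - 1))"
    using compositions_generating_function[OF assms(1), of UNIV s] geometric_fps_power_nth[of "card E" s]
    by simp
  thus ?thesis by (simp only: of_nat_eq_iff)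
qed

text \<open>The series of one coordinate is (1 - X^(t+1)) / (1 - X). Expanding the numerator of its
  n-th power binomially gives the inclusion-exclusion sum; the terms with j >= k drop out because (t
  + 1) j exceeds k t.\<close>

lemma card_compositions_atMost:
  assumes E: "finite E" and k: "0 < k" "k \<le> card E"
  shows "real (card (compositions {..t} E (k * t))) = poly (hypersimplex_poly (card E) k) (real t)"
proof -
  define n where "n = card E"
  have n: "n > 0" "k \<le> n" using k by (auto simp: n_def)
  let ?G = "Abs_fps (\<lambda>_. 1 :: real)"
  let ?Y = "fps_X ^ (t + 1) :: real fps"
  have trunc: "Abs_fps (\<lambda>j. of_bool (j \<in> {..t})) = (1 - ?Y) * ?G"
    unfolding left_diff_distrib by (rule fps_ext) (auto simp: fps_X_power_mult_nth simp del: power_Suc)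
  have "(1 - ?Y) ^ n = (\<Sum>j\<le>n. of_nat (n choose j) * (- ?Y) ^ j)"
    using binomial_ring[of "- ?Y" 1 n] by simp
  hence "((1 - ?Y) * ?G) ^ n = (\<Sum>j\<le>n. of_nat (n choose j) * (- ?Y) ^ j * ?G ^ n)"
    by (simp add: power_mult_distrib sum_distrib_right)
  also have "\<dots> = (\<Sum>j\<le>n. fps_const ((-1) ^ j * real (n choose j)) * (fps_X ^ ((t + 1) * j) * ?G ^ n))"
  proof (rule sum.cong[OF refl])
    fix j
    have "(- ?Y) ^ j = fps_const ((-1) ^ j) * fps_X ^ ((t + 1) * j)"
      unfolding power_minus[of ?Y] power_mult
      by (simp add: fps_const_power[symmetric] fps_const_neg[symmetric] del: fps_const_power fps_const_neg power_Suc)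
    thus "of_nat (n choose j) * (- ?Y) ^ j * ?G ^ n =
        fps_const ((-1) ^ j * real (n choose j)) * (fps_X ^ ((t + 1) * j) * ?G ^ n)"
      by (simp only: fps_const_mult[symmetric] fps_of_nat mult_ac)
  qed
  finally have gf: "((1 - ?Y) * ?G) ^ n =
     (\<Sum>j\<le>n. fps_const ((-1) ^ j * real (n choose j)) * (fps_X ^ ((t + 1) * j) * ?G ^ n))" .
  let ?g = "\<lambda>j. (-1) ^ j * real (n choose j) *
      (if k * t < (t + 1) * j then 0 else real ((k * t - (t + 1) * j + (n - 1)) choose (n - 1)))"
  have "real (card (compositions {..t} E (k * t))) = fps_nth (((1 - ?Y) * ?G) ^ n) (k * t)"
    using compositions_generating_function[OF E, of "{..t}" "k * t"] unfolding trunc n_def by simp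
  also have "\<dots> = (\<Sum>j\<le>n. ?g j)"
    unfolding gf fps_sum_nth
    by (intro sum.cong refl)
      (simp add: fps_X_power_mult_nth geometric_fps_power_nth[OF n(1)] del: mult_Suc mult_Suc_right)
  also have "\<dots> = (\<Sum>j<k. poly (katzman_term n k j) (real t))"
  proof (rule sum.mono_neutral_cong_right)
    show "\<forall>j\<in>{..n} - {..<k}. ?g j = 0"
    proof
      fix j assume "j \<in> {..n} - {..<k}"
      hence "(t + 1) * k \<le> (t + 1) * j" by (intro mult_le_mono) auto
      hence "k * t < (t + 1) * j" using k by (simp add: algebra_simps)
      thus "?g j = 0" by simp
    qed
  next
    fix j assume j: "j \<in> {..<k}"
    have jt: "j * t \<le> k * t" using j by simp
    show "?g j = poly (katzman_term n k j) (real t)"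
    proof (cases "k * t < (t + 1) * j")
      \<comment> \<open>Here the shift by (t + 1) j exceeds k t and the series has no such term. The
        polynomial agrees because the top of its binomial coefficient falls below n - 1.\<close>
      case True
      hence "k * t < j * t + j" by (simp add: algebra_simps)
      hence "(k - j) * t < j" unfolding diff_mult_distrib using jt by linarith
      hence "(k - j) * t + (n - 1 - j) < n - 1" using j n by simp
      hence "((k - j) * t + (n - 1 - j)) choose (n - 1) = 0"
        by (rule binomial_eq_0)
      then show ?thesis using True by (simp add: poly_katzman_term)
    next
      case False
      hence "k * t - (t + 1) * j + (n - 1) = (k - j) * t + (n - 1 - j)"
        using j n jt by (simp add: algebra_simps)
      then show ?thesis using False by (simp add: poly_katzman_term)
    qed
  qed (use n in auto)
  finally show ?thesis by (simp add: hypersimplex_poly_def poly_sum n_def)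
qed

text \<open>Each corner beyond the facet \<open>x(H) = (k - 1) t\<close> is described by the complement \<open>t - x\<close> on \<open>H\<close>
  and by \<open>x\<close> off \<open>H\<close>, which have the same total \<open>s < t\<close>; this makes the upper bounds \<open>x \<le> t\<close> automatic.\<close>

lemma corner_bij_betw:
  assumes E: "finite E" and H: "H \<subseteq> E" "card H = k" and k: "0 < k"
  shows "bij_betw (\<lambda>(s, g, h). \<lambda>i. if i \<in> H then t - g i else h i)
           (SIGMA s:{..<t}. compositions UNIV H s \<times> compositions UNIV (E - H) s)
           {f \<in> compositions {..t} E (k * t). sum f H > (k - 1) * t}"
    (is "bij_betw ?\<phi> ?S ?T")
proof -
  define \<psi> where "\<psi> = (\<lambda>f::'a \<Rightarrow> nat. (sum f (E - H), (\<lambda>i. if i \<in> H then t - f i else 0), (\<lambda>i. if i \<in> E - H then f i else 0)))"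
  have finH: "finite H" "finite (E - H)" using E H finite_subset by auto
  have split: "sum f E = sum f H + sum f (E - H)" for f :: "'a \<Rightarrow> nat"
    using sum.subset_diff[OF H(1) E, of f] by simp
  have compl: "sum (\<lambda>i. t - f i) H + sum f H = k * t" if "\<And>i. i \<in> H \<Longrightarrow> f i \<le> t" for f :: "'a \<Rightarrow> nat"
  proof -
    have "sum (\<lambda>i. t - f i) H + sum f H = (\<Sum>i\<in>H. t)"
      unfolding sum.distrib[symmetric] using that by (intro sum.cong) auto
    thus ?thesis using H by simp
  qed
  \<comment> \<open>As the sum over \<open>H\<close> plus s is k t, exceeding (k - 1) t on
    \<open>H\<close> amounts to s < t.\<close>
  have kt: "k * t = (k - 1) * t + t" using k by (cases k) auto
  have le: "g i \<le> sum g A" if "finite A" "i \<in> A" for g :: "'a \<Rightarrow> nat" and i A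
    using that by (intro member_le_sum) auto
  show ?thesis
  proof (rule bij_betw_byWitness[where f' = \<psi>])
    show "\<forall>x\<in>?S. \<psi> (?\<phi> x) = x"
    proof
      fix x assume "x \<in> ?S"
      then obtain s g h where x: "x = (s, g, h)" and s: "s < t"
        and g: "g \<in> compositions UNIV H s" and h: "h \<in> compositions UNIV (E - H) s" by auto
      have "g i \<le> t" if "i \<in> H" for i
        using le[OF finH(1) that, of g] g s by (auto simp: compositions_def)
      moreover have "(\<Sum>i\<in>E - H. if i \<in> H then t - g i else h i) = sum h (E - H)"
        by (intro sum.cong) auto
      ultimately show "\<psi> (?\<phi> x) = x"
        using g h x by (auto simp: \<psi>_def compositions_def fun_eq_iff)
    qed
    show "\<forall>f\<in>?T. ?\<phi> (\<psi> f) = f"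
      using H by (auto simp: \<psi>_def compositions_def fun_eq_iff)
    show "?\<phi> ` ?S \<subseteq> ?T"
    proof (rule image_subsetI)
      fix x assume "x \<in> ?S"
      then obtain s g h where x: "x = (s, g, h)" and s: "s < t"
        and g: "g \<in> compositions UNIV H s" and h: "h \<in> compositions UNIV (E - H) s" by auto
      let ?f = "\<lambda>i. if i \<in> H then t - g i else h i"
      have gle: "g i \<le> t" if "i \<in> H" for i
        using le[OF finH(1) that, of g] g s by (auto simp: compositions_def)
      have hle: "h i \<le> t" if "i \<in> E - H" for i
        using le[OF finH(2) that, of h] h s by (auto simp: compositions_def)
      have 1: "sum ?f (E - H) = s"
        using h by (auto simp: compositions_def intro!: sum.cong)
      have "sum ?f H = sum (\<lambda>i. t - g i) H" by (intro sum.cong) auto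
      hence 2: "sum ?f H + s = k * t"
        using compl[of g] gle g by (auto simp: compositions_def)
      have "?f \<in> compositions {..t} E (k * t)"
        using split[of ?f] 1 2 g h hle H by (auto simp: compositions_def)
      moreover have "sum ?f H > (k - 1) * t"
        using 2 s kt by simp
      ultimately show "?\<phi> x \<in> ?T"
        using x by simp
    qed
    show "\<psi> ` ?T \<subseteq> ?S"
    proof (rule image_subsetI)
      fix f assume "f \<in> ?T"
      hence f: "f \<in> compositions {..t} E (k * t)" and big: "sum f H > (k - 1) * t" by auto
      define s where "s = sum f (E - H)"
      define g where "g = (\<lambda>i. if i \<in> H then t - f i else 0)"
      define h where "h = (\<lambda>i. if i \<in> E - H then f i else 0)"
      have fle: "f i \<le> t" if "i \<in> H" for i using f that H by (auto simp: compositions_def)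
      have tot: "sum f H + s = k * t"
        using split[of f] f s_def by (auto simp: compositions_def)
      have "s < t" using tot big kt by linarith
      have "sum g H = sum (\<lambda>i. t - f i) H" using g_def by (intro sum.cong) auto
      hence "g \<in> compositions UNIV H s"
        using compl[of f] fle tot by (auto simp: compositions_def g_def)
      moreover have "h \<in> compositions UNIV (E - H) s"
        by (auto simp: compositions_def s_def h_def)
      ultimately show "\<psi> f \<in> ?S"
        using \<open>s < t\<close> by (simp add: \<psi>_def s_def g_def h_def)
    qed
  qed
qed

text \<open>For each s < t the two halves of the bijection are counted independently, with card H =
  k and card (E - H) = card E - k parts; \<open>poly_corner_poly\<close> sums the products.
  Strictness of k < card E keeps \<open>E - H\<close> nonempty.\<close>

lemma card_corner:
  assumes E: "finite E" and H: "H \<subseteq> E" "card H = k" and k: "0 < k" "k < card E"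
  shows "real (card {f \<in> compositions {..t} E (k * t). sum f H > (k - 1) * t}) =
    poly (corner_poly (k - 1) (card E - k - 1)) (real t)"
proof -
  have ne: "H \<noteq> {}" using H k by auto
  have fin: "finite H" "finite (E - H)" using E H finite_subset by auto
  have ne': "E - H \<noteq> {}"
  proof
    assume "E - H = {}"
    hence "E = H" using H by auto
    thus False using H k by simp
  qed
  have c: "card (E - H) = card E - k" using H card_Diff_subset[OF fin(1) H(1)] by simp
  have "card {f \<in> compositions {..t} E (k * t). sum f H > (k - 1) * t} =
     card (SIGMA s:{..<t}. compositions UNIV H s \<times> compositions UNIV (E - H) s)"
    using bij_betw_same_card[OF corner_bij_betw[OF E H k(1), of t]] by simp
  also have "\<dots> = (\<Sum>s<t. card (compositions UNIV H s) * card (compositions UNIV (E - H) s))"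
    using fin by (simp add: finite_compositions card_cartesian_product)
  also have "\<dots> = (\<Sum>s<t. ((s + (k - 1)) choose (k - 1)) * ((s + (card E - k - 1)) choose (card E - k - 1)))"
    using H c by (simp add: card_compositions_UNIV[OF fin(1) ne] card_compositions_UNIV[OF fin(2) ne'])
  finally show ?thesis by (simp only: poly_corner_poly)
qed

section \<open>Sparse families and the lattice point count\<close>

text \<open>The intersection bound says that no two members differ by a single exchange. The bound
  k^2 < card E leaves room around the barycentre of the hypersimplex inside every cut, and it yields
  the linear bounds needed elsewhere.\<close>

locale sparse_family =
  fixes E :: "'a set" and k :: nat and \<H> :: "'a set set"
  assumes finite_E: "finite E"
    and k_ge_3: "3 \<le> k"
    and card_E: "k\<^sup>2 < card E"
    and \<H>_sub: "\<And>H. H \<in> \<H> \<Longrightarrow> H \<subseteq> E"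
    and \<H>_card: "\<And>H. H \<in> \<H> \<Longrightarrow> card H = k"
    and \<H>_inter: "\<And>H H'. H \<in> \<H> \<Longrightarrow> H' \<in> \<H> \<Longrightarrow> H \<noteq> H' \<Longrightarrow> card (H \<inter> H') + 2 \<le> k"
begin

lemma card_E_bounds: "3 * k < card E" "k + 6 < card E" "k < card E" "0 < card E"
proof -
  have "3 * k \<le> k\<^sup>2" using k_ge_3 by (simp add: power2_eq_square)
  thus "3 * k < card E" "k + 6 < card E" "k < card E" "0 < card E" using card_E k_ge_3 by linarith+
qed

lemma finite_\<H>: "finite \<H>"
  using \<H>_sub finite_E by (intro finite_subset[of \<H> "Pow E"]) auto

lemma finite_H: "H \<in> \<H> \<Longrightarrow> finite H"
  using \<H>_sub finite_E finite_subset by blast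

text \<open>A model over the naturals of the integer points in the t-th dilate;
  \<open>card_dilation_integer_points\<close> makes the identification.\<close>

definition lattice_points :: "nat \<Rightarrow> ('a \<Rightarrow> nat) set" where
  "lattice_points t = {f \<in> compositions {..t} E (k * t). \<forall>H\<in>\<H>. sum f H \<le> (k - 1) * t}"

definition ehr_poly :: "real poly" where
  "ehr_poly = hypersimplex_poly (card E) k -
     smult (real (card \<H>)) (corner_poly (k - 1) (card E - k - 1))"

text \<open>The sum over the union is at most k t and that over the intersection at most (k - 2) t,
  together exactly 2 (k - 1) t, whereas two violated cuts would need strictly more.\<close>

lemma corners_disjoint:
  assumes "H \<in> \<H>" "H' \<in> \<H>" "H \<noteq> H'" "f \<in> compositions {..t} E (k * t)"
    and "sum f H > (k - 1) * t" "sum f H' > (k - 1) * t"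
  shows False
proof -
  have fin: "finite H" "finite H'" using assms finite_H by auto
  have "sum f H + sum f H' = sum f (H \<union> H') + sum f (H \<inter> H')"
    using sum.union_inter[OF fin, of f] by simp
  also have "sum f (H \<union> H') \<le> sum f E"
    using assms(1,2) \<H>_sub finite_E by (intro sum_mono2) auto
  also have "sum f E = k * t" using assms(4) by (auto simp: compositions_def)
  also have "sum f (H \<inter> H') \<le> card (H \<inter> H') * t"
    using sum_bounded_above[of "H \<inter> H'" f t] assms(1,4) \<H>_sub by (auto simp: compositions_def)
  also have "\<dots> \<le> (k - 2) * t" using \<H>_inter[OF assms(1-3)] by (intro mult_right_mono) auto
  finally have "sum f H + sum f H' \<le> k * t + (k - 2) * t" by simp
  moreover have "k * t + (k - 2) * t = (k - 1) * t + (k - 1) * t"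
  proof -
    obtain l where "k = l + 2" using k_ge_3 by (metis add.commute le_Suc_ex numeral_3_eq_3 add_2_eq_Suc' add_Suc_right)
    thus ?thesis by (simp add: algebra_simps)
  qed
  ultimately show False using assms(5,6) by linarith
qed

lemma card_lattice_points: "real (card (lattice_points t)) = poly ehr_poly (real t)"
proof -
  let ?W = "compositions {..t} E (k * t)"
  let ?C = "\<lambda>H. {f \<in> ?W. sum f H > (k - 1) * t}"
  have fin: "finite ?W" by (rule finite_compositions[OF finite_E])
  have eq: "lattice_points t = ?W - (\<Union>H\<in>\<H>. ?C H)"
    by (auto simp: lattice_points_def not_less)
  have "card (\<Union>H\<in>\<H>. ?C H) = (\<Sum>H\<in>\<H>. card (?C H))"
  proof (rule card_UN_disjoint[OF finite_\<H>])
    show "\<forall>H\<in>\<H>. finite (?C H)" using fin by simp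
    show "\<forall>H\<in>\<H>. \<forall>H'\<in>\<H>. H \<noteq> H' \<longrightarrow> ?C H \<inter> ?C H' = {}"
      using corners_disjoint by blast
  qed
  hence "real (card (\<Union>H\<in>\<H>. ?C H)) = (\<Sum>H\<in>\<H>. real (card (?C H)))" by simp
  also have "\<dots> = (\<Sum>H\<in>\<H>. poly (corner_poly (k - 1) (card E - k - 1)) (real t))"
    using k_ge_3 card_E_bounds by (intro sum.cong refl card_corner finite_E \<H>_sub \<H>_card) auto
  finally have corners: "real (card (\<Union>H\<in>\<H>. ?C H)) =
      real (card \<H>) * poly (corner_poly (k - 1) (card E - k - 1)) (real t)" by simp
  have sub: "(\<Union>H\<in>\<H>. ?C H) \<subseteq> ?W" by auto
  have "real (card (lattice_points t)) = real (card ?W) - real (card (\<Union>H\<in>\<H>. ?C H))"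
    unfolding eq using card_Diff_subset[OF finite_subset[OF sub fin] sub] card_mono[OF fin sub]
    by (simp add: of_nat_diff)
  also have "real (card ?W) = poly (hypersimplex_poly (card E) k) (real t)"
    using k_ge_3 card_E_bounds by (intro card_compositions_atMost[OF finite_E]) auto
  finally show ?thesis unfolding corners by (simp add: ehr_poly_def)
qed

lemma degree_ehr_poly_le: "degree ehr_poly \<le> card E - 1"
proof -
  have "(card E - k - 1) + (k - 1) + 1 = card E - 1"
    using k_ge_3 card_E_bounds by linarith
  hence "degree (corner_poly (k - 1) (card E - k - 1)) \<le> card E - 1"
    using degree_corner_poly_le[of "k - 1" "card E - k - 1"] by simp
  thus ?thesis unfolding ehr_poly_def
    by (intro degree_diff_le degree_hypersimplex_poly_le order.trans[OF degree_smult_le])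
qed

end

subsection \<open>The base polytope\<close>

lemma lookup_scaleR [simp]:
  fixes x :: "'a \<Rightarrow>\<^sub>0 real"
  shows "Poly_Mapping.lookup (r *\<^sub>R x) i = r * Poly_Mapping.lookup x i"
proof -
  have "finite {i. r * Poly_Mapping.lookup x i \<noteq> 0}"
    by (rule finite_subset[OF _ finite_lookup[of x]]) auto
  thus ?thesis by (simp add: scaleR_poly_mapping_def)
qed

lemma lookup_sum_single:
  assumes "finite A"
  shows "Poly_Mapping.lookup (\<Sum>i\<in>A. Poly_Mapping.single i (f i)) j = (if j \<in> A then f j else 0)"
  using assms by (simp add: lookup_sum lookup_single when_def sum.delta)

lemma lookup_indicator_vector:
  "finite B \<Longrightarrow> Poly_Mapping.lookup (indicator_vector B) j = of_bool (j \<in> B)"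
  unfolding indicator_vector_def by (subst lookup_sum_single) auto

lemma sum_lookup_add:
  "(\<Sum>i\<in>A. Poly_Mapping.lookup (x + y) i) = (\<Sum>i\<in>A. Poly_Mapping.lookup x i) + (\<Sum>i\<in>A. Poly_Mapping.lookup y i)"
  by (simp add: lookup_add sum.distrib)

lemma sum_lookup_scaleR:
  fixes x :: "'a \<Rightarrow>\<^sub>0 real"
  shows "(\<Sum>i\<in>A. Poly_Mapping.lookup (r *\<^sub>R x) i) = r * (\<Sum>i\<in>A. Poly_Mapping.lookup x i)"
  by (simp add: sum_distrib_left)

definition shift_dir :: "'a \<Rightarrow> 'a \<Rightarrow> ('a \<Rightarrow>\<^sub>0 real)" where
  "shift_dir i j = Poly_Mapping.single i 1 - Poly_Mapping.single j 1"

lemma lookup_shift_dir: "Poly_Mapping.lookup (shift_dir i j) l = of_bool (l = i) - of_bool (l = j)"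
  by (auto simp: shift_dir_def lookup_minus lookup_single when_def)

lemma sum_lookup_shift_dir:
  "finite A \<Longrightarrow> (\<Sum>l\<in>A. Poly_Mapping.lookup (shift_dir i j) l) = of_bool (i \<in> A) - of_bool (j \<in> A)"
  by (simp add: lookup_shift_dir sum_subtractf of_bool_def sum.delta)

lemma shift_dir_swap: "shift_dir j i = - shift_dir i j"
  by (simp add: shift_dir_def)

text \<open>Were the degree smaller, x^m - p(c x) would have leading coefficient 1 and become
  positive. Growth along the multiples of one c is enough, which leaves the choice of convenient
  dilations free.\<close>

lemma degree_ge_of_growth:
  fixes p :: "real poly"
  assumes "\<And>u. poly p (real (c * u)) \<ge> real u ^ m"
  shows "m \<le> degree p"
proof (rule ccontr)
  assume m: "\<not> m \<le> degree p"
  define q where "q = pcompose p [:0, real c:]"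
  have "degree q \<le> degree p"
    using degree_pcompose_le[of p "[:0, real c:]"] by (simp add: q_def split: if_splits)
  hence q: "degree q < m" using m by simp
  define r where "r = monom 1 m - q"
  have "coeff r m = 1" using q by (simp add: r_def coeff_eq_0)
  moreover have "degree r = m"
  proof (rule antisym)
    show "degree r \<le> m" unfolding r_def using q by (intro degree_diff_le degree_monom_le) auto
    show "m \<le> degree r" using \<open>coeff r m = 1\<close> by (intro le_degree) simp
  qed
  ultimately have "lead_coeff r = 1" by simp
  then obtain N where N: "\<And>x. x \<ge> N \<Longrightarrow> poly r x \<ge> 1"
    using poly_pinfty_gt_lc[of r] by auto
  obtain u :: nat where "real u \<ge> N" using real_arch_simple by blast
  hence "poly r (real u) \<ge> 1" using N by blast
  moreover have "poly r (real u) \<le> 0"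
    using assms[of u] by (simp add: r_def q_def poly_monom poly_pcompose mult.commute)
  ultimately show False by simp
qed

section \<open>The base polytope by inequalities\<close>

context sparse_family
begin

definition bases :: "'a set set" where
  "bases = {B. B \<subseteq> E \<and> card B = k \<and> B \<notin> \<H>}"

text \<open>The hypersimplex with its corners cut off, described by inequalities;
  \<open>base_polytope_eq\<close> shows that it is the hull of the bases.\<close>

definition cut_polytope :: "('a \<Rightarrow>\<^sub>0 real) set" where
  "cut_polytope = {x. (\<forall>i. i \<notin> E \<longrightarrow> Poly_Mapping.lookup x i = 0) \<and>
     (\<forall>i\<in>E. 0 \<le> Poly_Mapping.lookup x i \<and> Poly_Mapping.lookup x i \<le> 1) \<and>
     (\<Sum>i\<in>E. Poly_Mapping.lookup x i) = real k \<and>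
     (\<forall>H\<in>\<H>. (\<Sum>i\<in>H. Poly_Mapping.lookup x i) \<le> real k - 1)}"

lemma convex_cut_polytope: "convex cut_polytope"
proof (rule convexI)
  fix x y u v assume x: "x \<in> cut_polytope" and y: "y \<in> cut_polytope"
    and uv: "0 \<le> (u::real)" "0 \<le> v" "u + v = 1"
  have cc: "u * a + v * b \<le> c" if "a \<le> c" "b \<le> c" for a b c :: real
    using convex_bound_le[OF that uv] .
  show "u *\<^sub>R x + v *\<^sub>R y \<in> cut_polytope"
    using x y uv cc unfolding cut_polytope_def
    by (auto simp: sum_lookup_add sum_lookup_scaleR simp del: lookup_scaleR)
      (auto simp: lookup_add distrib_right[symmetric])
qed

text \<open>A basis violates a cut only if it meets \<open>H\<close> in k elements, and then it
  equals \<open>H\<close>.\<close>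

lemma indicator_vector_mem_cut_polytope:
  assumes "B \<in> bases"
  shows "indicator_vector B \<in> cut_polytope"
proof -
  have B: "B \<subseteq> E" "card B = k" "B \<notin> \<H>" "finite B"
    using assms finite_E finite_subset by (auto simp: bases_def)
  have s: "(\<Sum>i\<in>A. Poly_Mapping.lookup (indicator_vector B) i) = real (card (A \<inter> B))" if "finite A" for A
    using that B by (simp add: lookup_indicator_vector of_bool_def sum.If_cases Int_def)
  have "card (H \<inter> B) \<le> k - 1" if H: "H \<in> \<H>" for H
  proof (rule ccontr)
    assume "\<not> card (H \<inter> B) \<le> k - 1"
    hence *: "card (H \<inter> B) \<ge> k" by simp
    have "H \<inter> B = H" using * H \<H>_card finite_H card_seteq[of H "H \<inter> B"] by auto
    moreover have "H \<inter> B = B" using * B card_seteq[of B "H \<inter> B"] by auto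
    ultimately show False using H B by simp
  qed
  hence "real (card (H \<inter> B)) \<le> real k - 1" if "H \<in> \<H>" for H
  proof -
    have "card (H \<inter> B) + 1 \<le> k" using \<open>\<And>H. H \<in> \<H> \<Longrightarrow> card (H \<inter> B) \<le> k - 1\<close>[OF that] k_ge_3 by linarith
    thus ?thesis by linarith
  qed
  moreover have "E \<inter> B = B" using B by blast
  ultimately show ?thesis
    using B finite_E by (auto simp: cut_polytope_def s finite_H lookup_indicator_vector)
qed

abbreviation fractional :: "('a \<Rightarrow>\<^sub>0 real) \<Rightarrow> 'a set" where
  "fractional x \<equiv> {i \<in> E. 0 < Poly_Mapping.lookup x i \<and> Poly_Mapping.lookup x i < 1}"

abbreviation slack :: "('a \<Rightarrow>\<^sub>0 real) \<Rightarrow> 'a set set" where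
  "slack x \<equiv> {H \<in> \<H>. (\<Sum>i\<in>H. Poly_Mapping.lookup x i) < real k - 1}"

text \<open>A nonintegral point of the cut hypersimplex lies on a segment in direction \<open>e\<^sub>i - e\<^sub>j\<close> that keeps
  every integral coordinate and every tight constraint; at both ends of it a further coordinate
  becomes integral or a further constraint tight, so an induction leads down to bases.\<close>

lemma push_to_facet:
  assumes x: "x \<in> cut_polytope" and i: "i \<in> fractional x" and j: "j \<in> fractional x" and ij: "i \<noteq> j"
    and tight: "\<And>H. H \<in> \<H> - slack x \<Longrightarrow> i \<in> H \<longleftrightarrow> j \<in> H"
  shows "\<exists>\<alpha>>0. x + \<alpha> *\<^sub>R shift_dir i j \<in> cut_polytope \<and>
     card (fractional (x + \<alpha> *\<^sub>R shift_dir i j)) + card (slack (x + \<alpha> *\<^sub>R shift_dir i j)) <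
     card (fractional x) + card (slack x)"
proof -
  let ?l = "Poly_Mapping.lookup"
  \<comment> \<open>Along e_i - e_j only the constraints of these sets become tighter. Together with
    x_i <= 1 and x_j >= 0 they determine the longest admissible step, the minimum of
    \<open>S\<close>.\<close>
  define T where "T = {H \<in> \<H>. i \<in> H \<and> j \<notin> H}"
  define S where "S = {1 - ?l x i, ?l x j} \<union> (\<lambda>H. real k - 1 - (\<Sum>i\<in>H. ?l x i)) ` T"
  have finS: "finite S" using finite_\<H> by (simp add: S_def T_def)
  have T_slack: "H \<in> slack x" if "H \<in> T" for H using that tight[of H] by (auto simp: T_def)
  define \<alpha> where "\<alpha> = Min S"
  have \<alpha>S: "\<alpha> \<in> S" unfolding \<alpha>_def using finS by (intro Min_in) (auto simp: S_def)
  have \<alpha>le: "\<alpha> \<le> s" if "s \<in> S" for s unfolding \<alpha>_def using finS that by (rule Min_le)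
  have "s > 0" if "s \<in> S" for s
    using that i j T_slack by (auto simp: S_def)
  hence \<alpha>: "\<alpha> > 0" using \<alpha>S by blast
  have \<alpha>i: "\<alpha> \<le> 1 - ?l x i" and \<alpha>j: "\<alpha> \<le> ?l x j"
    using \<alpha>le by (auto simp: S_def)
  have \<alpha>H: "\<alpha> \<le> real k - 1 - (\<Sum>i\<in>H. ?l x i)" if "H \<in> T" for H
    using \<alpha>le that by (auto simp: S_def)
  define y where "y = x + \<alpha> *\<^sub>R shift_dir i j"
  have ly: "?l y l = ?l x l + \<alpha> * (of_bool (l = i) - of_bool (l = j))" for l
    by (simp add: y_def lookup_add lookup_shift_dir)
  have sy: "(\<Sum>l\<in>A. ?l y l) = (\<Sum>l\<in>A. ?l x l) + \<alpha> * (of_bool (i \<in> A) - of_bool (j \<in> A))" if "finite A" for A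
    using that unfolding y_def sum_lookup_add sum_lookup_scaleR by (simp add: sum_lookup_shift_dir)
  have yH: "(\<Sum>l\<in>H. ?l y l) \<le> real k - 1" if H: "H \<in> \<H>" for H
  proof (cases "H \<in> T")
    case True
    then show ?thesis using \<alpha>H[OF True] H by (simp add: sy finite_H T_def)
  next
    case False
    hence "\<alpha> * (of_bool (i \<in> H) - of_bool (j \<in> H)) \<le> 0"
      using \<alpha> H by (auto simp: T_def)
    moreover have "(\<Sum>l\<in>H. ?l x l) \<le> real k - 1" using x H by (simp add: cut_polytope_def)
    ultimately show ?thesis using H by (simp add: sy finite_H)
  qed
  have yQ: "y \<in> cut_polytope"
  proof -
    have "?l y l = 0" if "l \<notin> E" for l
      using that i j x by (auto simp: ly cut_polytope_def)
    moreover have "0 \<le> ?l y l \<and> ?l y l \<le> 1" if "l \<in> E" for l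
    proof -
      have "0 \<le> ?l x l" "?l x l \<le> 1" using x that by (auto simp: cut_polytope_def)
      thus ?thesis using \<alpha> \<alpha>i \<alpha>j ij by (auto simp: ly of_bool_def)
    qed
    moreover have "(\<Sum>l\<in>E. ?l y l) = real k"
      using x i j finite_E by (simp add: sy cut_polytope_def)
    ultimately show ?thesis using yH by (simp add: cut_polytope_def)
  qed
  have F: "fractional y \<subseteq> fractional x"
    using i j by (auto simp: ly of_bool_def split: if_splits)
  have Sl: "slack y \<subseteq> slack x"
  proof
    fix H assume H: "H \<in> slack y"
    show "H \<in> slack x"
    proof (rule ccontr)
      assume n: "H \<notin> slack x"
      hence "i \<in> H \<longleftrightarrow> j \<in> H" using tight[of H] H by blast
      hence "(\<Sum>l\<in>H. ?l y l) = (\<Sum>l\<in>H. ?l x l)" using H by (simp add: sy finite_H)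
      thus False using n H by simp
    qed
  qed
  have fin: "finite (fractional x)" "finite (slack x)" using finite_E finite_\<H> by auto
  \<comment> \<open>Whichever element of \<open>S\<close> attains the minimum names the coordinate
    that has become integral or the constraint that has become tight.\<close>
  have "fractional y \<noteq> fractional x \<or> slack y \<noteq> slack x"
  proof -
    consider "\<alpha> = 1 - ?l x i" | "\<alpha> = ?l x j" | H where "H \<in> T" "\<alpha> = real k - 1 - (\<Sum>i\<in>H. ?l x i)"
      using \<alpha>S by (auto simp: S_def)
    thus ?thesis
    proof cases
      case 1
      hence "i \<notin> fractional y" using ij by (simp add: ly)
      thus ?thesis using i by blast
    next
      case 2
      hence "j \<notin> fractional y" using ij by (simp add: ly)
      thus ?thesis using j by blast
    next
      case 3
      hence "H \<notin> slack y" by (simp add: sy finite_H T_def)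
      thus ?thesis using T_slack[OF 3(1)] by blast
    qed
  qed
  hence "fractional y \<subset> fractional x \<or> slack y \<subset> slack x"
    using F Sl by blast
  hence "card (fractional y) < card (fractional x) \<or> card (slack y) < card (slack x)"
    using psubset_card_mono[OF fin(1)] psubset_card_mono[OF fin(2)] by blast
  moreover have "card (fractional y) \<le> card (fractional x)" "card (slack y) \<le> card (slack x)"
    using F Sl fin by (auto intro: card_mono)
  ultimately have "card (fractional y) + card (slack y) < card (fractional x) + card (slack x)"
    by linarith
  thus ?thesis using \<alpha> yQ unfolding y_def by blast
qed

text \<open>An integral sum cannot have exactly one nonintegral summand.\<close>

lemma another_fractional:
  assumes x: "x \<in> cut_polytope" and A: "A \<subseteq> E" "(\<Sum>i\<in>A. Poly_Mapping.lookup x i) \<in> \<int>"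
    and i: "i \<in> fractional x \<inter> A"
  shows "\<exists>j\<in>fractional x \<inter> A. j \<noteq> i"
proof (rule ccontr)
  assume *: "\<not> ?thesis"
  have fin: "finite A" using A finite_E finite_subset by blast
  have "Poly_Mapping.lookup x j \<in> \<int>" if "j \<in> A - {i}" for j
  proof -
    have "j \<in> E" "j \<notin> fractional x" using * that A by auto
    hence "Poly_Mapping.lookup x j = 0 \<or> Poly_Mapping.lookup x j = 1"
      using x by (force simp: cut_polytope_def)
    thus ?thesis by auto
  qed
  hence "(\<Sum>j\<in>A - {i}. Poly_Mapping.lookup x j) \<in> \<int>" by (rule Ints_sum)
  moreover have "(\<Sum>j\<in>A. Poly_Mapping.lookup x j) =
      Poly_Mapping.lookup x i + (\<Sum>j\<in>A - {i}. Poly_Mapping.lookup x j)"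
    using i fin by (intro sum.remove) auto
  ultimately have "Poly_Mapping.lookup x i \<in> \<int>"
    using A(2) Ints_diff by (metis add_diff_cancel_right')
  then obtain z where z: "Poly_Mapping.lookup x i = of_int z" by (auto elim: Ints_cases)
  hence "0 < z" "z < 1" using i by auto
  thus False by simp
qed

text \<open>Two tight constraints add up to 2 k - 2, while the union contributes at most k and the
  intersection at most its size, at most k - 2. Equality must hold throughout, so x is 0 off the
  union and 1 on the intersection.\<close>

lemma two_tight_sets:
  assumes x: "x \<in> cut_polytope" and H: "H \<in> \<H> - slack x" "H' \<in> \<H> - slack x" "H \<noteq> H'"
  shows "fractional x \<inter> (H \<inter> H') = {}" "fractional x \<subseteq> H \<union> H'"
proof -
  let ?l = "Poly_Mapping.lookup x"
  have fin: "finite H" "finite H'" using H finite_H by auto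
  have sub: "H \<subseteq> E" "H' \<subseteq> E" using H \<H>_sub by auto
  have l: "0 \<le> ?l i" "?l i \<le> 1" if "i \<in> E" for i using x that by (auto simp: cut_polytope_def)
  have "sum ?l H = real k - 1" "sum ?l H' = real k - 1"
    using H x by (auto simp: cut_polytope_def not_less intro: antisym)
  hence 1: "sum ?l (H \<union> H') + sum ?l (H \<inter> H') = 2 * real k - 2"
    using sum.union_inter[OF fin, of ?l] by simp
  have "sum ?l E = real k" using x by (simp add: cut_polytope_def)
  moreover have "sum ?l E = sum ?l (E - (H \<union> H')) + sum ?l (H \<union> H')"
    using sub finite_E by (intro sum.subset_diff) auto
  moreover have z0: "sum ?l (E - (H \<union> H')) \<ge> 0" using l by (intro sum_nonneg) auto
  moreover have c: "real (card (H \<inter> H')) \<le> real k - 2"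
    using \<H>_inter[of H H'] H by (simp add: of_nat_le_iff[symmetric, where 'a = real] del: of_nat_le_iff)
  moreover have i0: "(\<Sum>i\<in>H \<inter> H'. 1 - ?l i) \<ge> 0" using l sub by (intro sum_nonneg) auto
  moreover have "(\<Sum>i\<in>H \<inter> H'. 1 - ?l i) = real (card (H \<inter> H')) - sum ?l (H \<inter> H')"
    by (simp add: sum_subtractf)
  ultimately have e: "sum ?l (E - (H \<union> H')) = 0" "(\<Sum>i\<in>H \<inter> H'. 1 - ?l i) = 0"
    using 1 by linarith+
  have "?l i = 0" if "i \<in> E - (H \<union> H')" for i
    using e(1) l finite_E that by (subst (asm) sum_nonneg_eq_0_iff) auto
  thus "fractional x \<subseteq> H \<union> H'" by fastforce
  have "1 - ?l i = 0" if "i \<in> H \<inter> H'" for i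
    using e(2) l sub fin that by (subst (asm) sum_nonneg_eq_0_iff) auto
  thus "fractional x \<inter> (H \<inter> H') = {}" by fastforce
qed

text \<open>One tight set suffices for choosing the pair: by \<open>two_tight_sets\<close> every
  fractional coordinate lies in exactly one of two tight sets, so agreeing on one of them means
  agreeing on the other.\<close>

lemma fractional_pair:
  assumes x: "x \<in> cut_polytope" and ne: "fractional x \<noteq> {}"
  shows "\<exists>i\<in>fractional x. \<exists>j\<in>fractional x. i \<noteq> j \<and> (\<forall>H\<in>\<H> - slack x. i \<in> H \<longleftrightarrow> j \<in> H)"
proof -
  obtain i where i: "i \<in> fractional x" using ne by blast
  have E: "(\<Sum>i\<in>E. Poly_Mapping.lookup x i) = real k" using x by (simp add: cut_polytope_def)
  show ?thesis
  proof (cases "\<H> - slack x = {}")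
    case True
    obtain j where "j \<in> fractional x" "j \<noteq> i"
      using another_fractional[OF x, of E i] E i by auto
    thus ?thesis using True i by blast
  next
    case False
    then obtain H where H: "H \<in> \<H> - slack x" by blast
    have sH: "(\<Sum>i\<in>H. Poly_Mapping.lookup x i) = real k - 1"
      using H x by (auto simp: cut_polytope_def not_less intro: antisym)
    have sE: "(\<Sum>i\<in>E. Poly_Mapping.lookup x i) =
        (\<Sum>i\<in>E - H. Poly_Mapping.lookup x i) + (\<Sum>i\<in>H. Poly_Mapping.lookup x i)"
      using H \<H>_sub finite_E by (intro sum.subset_diff) auto
    \<comment> \<open>The sums over \<open>H\<close> and over \<open>E - H\<close> are k - 1 and 1,
      both integral, so a partner exists on whichever side i lies.\<close>
    have "\<exists>j\<in>fractional x. j \<noteq> i \<and> (i \<in> H \<longleftrightarrow> j \<in> H)"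
    proof (cases "i \<in> H")
      case True
      thus ?thesis using another_fractional[OF x, of H i] H \<H>_sub sH i by auto
    next
      case False
      thus ?thesis using another_fractional[OF x, of "E - H" i] sH sE E i by auto
    qed
    then obtain j where j: "j \<in> fractional x" "j \<noteq> i" "i \<in> H \<longleftrightarrow> j \<in> H" by blast
    have "i \<in> H' \<longleftrightarrow> j \<in> H'" if "H' \<in> \<H> - slack x" for H'
      using two_tight_sets[OF x H that] i j by (cases "H = H'") blast+
    thus ?thesis using i j by blast
  qed
qed

lemma cut_polytope_subset: "cut_polytope \<subseteq> base_polytope bases"
proof
  fix x assume "x \<in> cut_polytope"
  thus "x \<in> base_polytope bases"
  proof (induction "card (fractional x) + card (slack x)" arbitrary: x rule: less_induct)
    case less
    note x = less.prems
    show ?case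
    proof (cases "fractional x = {}")
      case True
      have l: "Poly_Mapping.lookup x i = 0 \<or> Poly_Mapping.lookup x i = 1" if "i \<in> E" for i
        using True x that by (force simp: cut_polytope_def)
      define B where "B = {i \<in> E. Poly_Mapping.lookup x i = 1}"
      have finB: "finite B" using finite_E by (simp add: B_def)
      have lB: "Poly_Mapping.lookup x i = of_bool (i \<in> B)" for i
        using l x by (cases "i \<in> E") (auto simp: B_def cut_polytope_def)
      have "x = indicator_vector B"
        by (rule poly_mapping_eqI) (simp add: lB lookup_indicator_vector[OF finB])
      moreover have "B \<in> bases"
      proof -
        have "real k = (\<Sum>i\<in>E. of_bool (i \<in> B))" using x by (simp add: cut_polytope_def lB)
        also have "\<dots> = real (card (E \<inter> B))" using finite_E by (simp add: of_bool_def sum.If_cases Int_def)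
        also have "E \<inter> B = B" by (auto simp: B_def)
        finally have cB: "card B = k" by simp
        have "B \<notin> \<H>"
        proof
          assume "B \<in> \<H>"
          hence "(\<Sum>i\<in>B. Poly_Mapping.lookup x i) \<le> real k - 1" using x by (simp add: cut_polytope_def)
          thus False using cB by (simp add: lB)
        qed
        thus ?thesis using cB by (auto simp: bases_def B_def)
      qed
      ultimately show ?thesis by (auto simp: base_polytope_def intro: hull_inc)
    next
      case False
      then obtain i j where ij: "i \<in> fractional x" "j \<in> fractional x" "i \<noteq> j"
        and t: "\<And>H. H \<in> \<H> - slack x \<Longrightarrow> i \<in> H \<longleftrightarrow> j \<in> H"
        using fractional_pair[OF x] by blast
      obtain \<alpha> where \<alpha>: "\<alpha> > 0" "x + \<alpha> *\<^sub>R shift_dir i j \<in> base_polytope bases"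
        using push_to_facet[OF x ij t] less.hyps by blast
      obtain \<beta> where \<beta>: "\<beta> > 0" "x + \<beta> *\<^sub>R shift_dir j i \<in> base_polytope bases"
        using push_to_facet[OF x ij(2,1) ij(3)[symmetric] t[symmetric]] less.hyps by blast
      \<comment> \<open>The weights are crossed, so the displacements \<alpha> and \<beta> in
        opposite directions cancel and x is recovered.\<close>
      let ?a = "\<alpha> / (\<alpha> + \<beta>)" and ?b = "\<beta> / (\<alpha> + \<beta>)"
      have ab: "?b + ?a = 1" using \<alpha> \<beta> by (simp add: add_divide_distrib[symmetric])
      have "?b *\<^sub>R (x + \<alpha> *\<^sub>R shift_dir i j) + ?a *\<^sub>R (x + \<beta> *\<^sub>R shift_dir j i) \<in> base_polytope bases"
        using \<alpha> \<beta> ab by (intro convexD) (auto simp: base_polytope_def convex_convex_hull)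
      moreover have "?b *\<^sub>R (x + \<alpha> *\<^sub>R shift_dir i j) + ?a *\<^sub>R (x + \<beta> *\<^sub>R shift_dir j i) =
          (?b + ?a) *\<^sub>R x"
        by (simp add: shift_dir_swap[of j i] algebra_simps)
      ultimately show ?thesis using ab by simp
    qed
  qed
qed

lemma base_polytope_eq: "base_polytope bases = cut_polytope"
proof
  show "base_polytope bases \<subseteq> cut_polytope"
    unfolding base_polytope_def using indicator_vector_mem_cut_polytope
    by (intro hull_minimal convex_cut_polytope) auto
qed (rule cut_polytope_subset)

section \<open>Dimension, degree and identification of the Ehrhart polynomial\<close>

definition center :: "'a \<Rightarrow>\<^sub>0 real" where
  "center = (\<Sum>i\<in>E. Poly_Mapping.single i (real k / real (card E)))"

text \<open>The barycentre has room 1 / n in every direction e_i - e_j. For the cuts, k^2 + 1 <= n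
  gives k (k / n) + 1 / n <= 1, which is at most k - 1.\<close>

lemma near_center_mem_cut_polytope:
  assumes "i \<in> E" "j \<in> E" "0 \<le> s" "s \<le> 1 / real (card E)"
  shows "center + s *\<^sub>R shift_dir i j \<in> cut_polytope"
proof -
  let ?n = "real (card E)"
  let ?y = "center + s *\<^sub>R shift_dir i j"
  have n: "?n > 0" using card_E_bounds by simp
  have k2: "(real k)\<^sup>2 + 1 \<le> ?n"
    using card_E by (metis Suc_eq_plus1 Suc_leI of_nat_1 of_nat_add of_nat_le_iff of_nat_power)
  have ly: "Poly_Mapping.lookup ?y l = (if l \<in> E then real k / ?n else 0) + s * (of_bool (l = i) - of_bool (l = j))" for l
    by (simp add: lookup_add lookup_shift_dir center_def lookup_sum_single[OF finite_E])
  have sy: "(\<Sum>l\<in>A. Poly_Mapping.lookup ?y l) = real (card A) * (real k / ?n) + s * (of_bool (i \<in> A) - of_bool (j \<in> A))"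
    if A: "A \<subseteq> E" for A
  proof -
    have "finite A" using A finite_E finite_subset by blast
    moreover have "(\<Sum>l\<in>A. Poly_Mapping.lookup center l) = real (card A) * (real k / ?n)"
      using A by (subst sum.cong[OF refl, where h = "\<lambda>_. real k / ?n"])
        (auto simp: center_def lookup_sum_single[OF finite_E])
    ultimately show ?thesis unfolding sum_lookup_add sum_lookup_scaleR by (simp add: sum_lookup_shift_dir)
  qed
  have s: "s * ?n \<le> 1" using assms(4) n by (simp add: field_simps)
  have kn: "real k / ?n + s \<le> 1"
  proof -
    have "real k + 1 \<le> ?n" using card_E_bounds by linarith
    moreover have "(real k / ?n + s) * ?n = real k + s * ?n" using n by (simp add: field_simps)
    ultimately have "(real k / ?n + s) * ?n \<le> 1 * ?n" using s by linarith
    thus ?thesis using n by (rule mult_right_le_imp_le)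
  qed
  have ks: "s \<le> real k / ?n"
  proof -
    have "1 / ?n \<le> real k / ?n" using k_ge_3 n by (intro divide_right_mono) auto
    thus ?thesis using assms by linarith
  qed
  have H: "real k * (real k / ?n) + s \<le> real k - 1"
  proof -
    have "(real k * (real k / ?n) + s) * ?n = (real k)\<^sup>2 + s * ?n"
      using n by (simp add: field_simps power2_eq_square)
    also have "\<dots> \<le> 1 * ?n" using s k2 by linarith
    finally have "real k * (real k / ?n) + s \<le> 1" using n by (rule mult_right_le_imp_le)
    thus ?thesis using k_ge_3 by linarith
  qed
  have "0 \<le> Poly_Mapping.lookup ?y l \<and> Poly_Mapping.lookup ?y l \<le> 1" if "l \<in> E" for l
  proof -
    have "0 \<le> real k / ?n" by simp
    thus ?thesis using kn ks assms that unfolding ly by (auto simp: of_bool_def)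
  qed
  moreover have "Poly_Mapping.lookup ?y l = 0" if "l \<notin> E" for l
    using assms that unfolding ly by auto
  moreover have "(\<Sum>l\<in>E. Poly_Mapping.lookup ?y l) = real k"
    using assms n by (subst sy) auto
  moreover have "(\<Sum>l\<in>A. Poly_Mapping.lookup ?y l) \<le> real k - 1" if "A \<in> \<H>" for A
  proof -
    have "s * (of_bool (i \<in> A) - of_bool (j \<in> A)) \<le> s" using assms by (auto simp: of_bool_def)
    thus ?thesis using H that \<H>_sub \<H>_card by (subst sy) fastforce+
  qed
  ultimately show ?thesis by (simp add: cut_polytope_def)
qed

lemma center_mem_cut_polytope: "center \<in> cut_polytope"
proof -
  obtain e where "e \<in> E" using card_E_bounds by fastforce
  thus ?thesis using near_center_mem_cut_polytope[of e e 0] by simp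
qed

lemma mem_dilation_iff:
  "x \<in> (*\<^sub>R) (real t) ` cut_polytope \<longleftrightarrow>
    (\<forall>i. i \<notin> E \<longrightarrow> Poly_Mapping.lookup x i = 0) \<and>
    (\<forall>i\<in>E. 0 \<le> Poly_Mapping.lookup x i \<and> Poly_Mapping.lookup x i \<le> real t) \<and>
    (\<Sum>i\<in>E. Poly_Mapping.lookup x i) = real (k * t) \<and>
    (\<forall>H\<in>\<H>. (\<Sum>i\<in>H. Poly_Mapping.lookup x i) \<le> real ((k - 1) * t))" (is "_ \<longleftrightarrow> ?R x")
proof
  have k1: "real (k - 1) = real k - 1" using k_ge_3 by simp
  show "?R x" if "x \<in> (*\<^sub>R) (real t) ` cut_polytope"
  proof -
    obtain q where q: "q \<in> cut_polytope" and x: "x = real t *\<^sub>R q" using \<open>x \<in> _\<close> by blast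
    have "(\<Sum>i\<in>H. Poly_Mapping.lookup x i) \<le> real ((k - 1) * t)" if "H \<in> \<H>" for H
    proof -
      have "(\<Sum>i\<in>H. Poly_Mapping.lookup x i) = real t * (\<Sum>i\<in>H. Poly_Mapping.lookup q i)"
        unfolding x sum_lookup_scaleR ..
      also have "\<dots> \<le> real t * (real k - 1)"
        using q that by (intro mult_left_mono) (auto simp: cut_polytope_def)
      finally show ?thesis unfolding of_nat_mult k1 by (simp add: mult.commute)
    qed
    moreover have "(\<Sum>i\<in>E. Poly_Mapping.lookup x i) = real (k * t)"
      using q unfolding x sum_lookup_scaleR by (simp add: cut_polytope_def)
    moreover have "Poly_Mapping.lookup x i \<le> real t" if "i \<in> E" for i
      using q that mult_left_mono[of "Poly_Mapping.lookup q i" 1 "real t"] by (auto simp: x cut_polytope_def)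
    ultimately show ?thesis using q by (auto simp: x cut_polytope_def)
  qed
  show "x \<in> (*\<^sub>R) (real t) ` cut_polytope" if R: "?R x"
  proof (cases "t = 0")
    \<comment> \<open>For t = 0 the conditions force x = 0, and a point of the polytope is needed as
      preimage; \<open>center\<close> supplies it.\<close>
    case True
    have "Poly_Mapping.lookup x i = 0" for i using R True by (cases "i \<in> E") auto
    hence "x = 0" by (intro poly_mapping_eqI) simp
    thus ?thesis using True center_mem_cut_polytope by auto
  next
    case False
    let ?q = "(1 / real t) *\<^sub>R x"
    have q: "(\<Sum>i\<in>A. Poly_Mapping.lookup ?q i) = (\<Sum>i\<in>A. Poly_Mapping.lookup x i) / real t" for A
      unfolding sum_lookup_scaleR by simp
    have "(\<Sum>i\<in>H. Poly_Mapping.lookup ?q i) \<le> real k - 1" if "H \<in> \<H>" for H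
    proof -
      have "(\<Sum>i\<in>H. Poly_Mapping.lookup x i) \<le> (real k - 1) * real t"
        using R that unfolding of_nat_mult k1 by blast
      thus ?thesis unfolding q using False by (simp add: divide_le_eq)
    qed
    moreover have "(\<Sum>i\<in>E. Poly_Mapping.lookup ?q i) = real k"
      unfolding q using R False by simp
    ultimately have "?q \<in> cut_polytope"
      unfolding cut_polytope_def using R False by (simp add: divide_le_eq)
    moreover have "x = real t *\<^sub>R ?q" using False by simp
    ultimately show ?thesis by blast
  qed
qed

lemma card_dilation_integer_points:
  "card ((*\<^sub>R) (real t) ` base_polytope bases \<inter> integer_points) = card (lattice_points t)"
proof -
  define \<phi> :: "('a \<Rightarrow> nat) \<Rightarrow> ('a \<Rightarrow>\<^sub>0 real)" where
    "\<phi> f = (\<Sum>i\<in>E. Poly_Mapping.single i (real (f i)))" for f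
  have l: "Poly_Mapping.lookup (\<phi> f) = (\<lambda>i. real (f i))" if "\<And>i. i \<notin> E \<Longrightarrow> f i = 0" for f
    using that by (auto simp: \<phi>_def lookup_sum_single[OF finite_E] fun_eq_iff)
  have l': "Poly_Mapping.lookup (\<phi> f) = (\<lambda>i. real (f i))" if "f \<in> lattice_points t" for f
    using that by (intro l) (auto simp: lattice_points_def compositions_def)
  have "inj_on \<phi> (lattice_points t)"
  proof (rule inj_onI)
    fix f g assume fg: "f \<in> lattice_points t" "g \<in> lattice_points t" "\<phi> f = \<phi> g"
    have "(\<lambda>i. real (f i)) = (\<lambda>i. real (g i))" using l'[OF fg(1)] l'[OF fg(2)] fg(3) by simp
    thus "f = g" by (auto simp: fun_eq_iff)
  qed
  moreover have "\<phi> ` lattice_points t = (*\<^sub>R) (real t) ` cut_polytope \<inter> integer_points"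
  proof
    show "\<phi> ` lattice_points t \<subseteq> (*\<^sub>R) (real t) ` cut_polytope \<inter> integer_points"
    proof (rule image_subsetI)
      fix f assume f: "f \<in> lattice_points t"
      have "\<phi> f \<in> (*\<^sub>R) (real t) ` cut_polytope"
        using f unfolding mem_dilation_iff l'[OF f] of_nat_sum[symmetric] of_nat_le_iff of_nat_eq_iff
        by (auto simp: lattice_points_def compositions_def)
      moreover have "\<phi> f \<in> integer_points" by (simp add: integer_points_def l'[OF f])
      ultimately show "\<phi> f \<in> (*\<^sub>R) (real t) ` cut_polytope \<inter> integer_points" by blast
    qed
    show "(*\<^sub>R) (real t) ` cut_polytope \<inter> integer_points \<subseteq> \<phi> ` lattice_points t"
    proof
      fix x assume "x \<in> (*\<^sub>R) (real t) ` cut_polytope \<inter> integer_points"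
      hence x: "x \<in> (*\<^sub>R) (real t) ` cut_polytope" and int: "\<And>i. Poly_Mapping.lookup x i \<in> \<int>"
        by (auto simp: integer_points_def)
      note R = x[unfolded mem_dilation_iff]
      define f where "f i = nat \<lfloor>Poly_Mapping.lookup x i\<rfloor>" for i
      have nn: "Poly_Mapping.lookup x i \<ge> 0" for i using R by (cases "i \<in> E") auto
      have f: "Poly_Mapping.lookup x i = real (f i)" for i
        using int[of i] nn[of i] by (auto simp: f_def elim!: Ints_cases)
      have "f \<in> lattice_points t"
        using R unfolding f of_nat_sum[symmetric] of_nat_le_iff of_nat_eq_iff
        by (auto simp: lattice_points_def compositions_def)
      moreover have "x = \<phi> f"
        using l'[OF calculation] by (intro poly_mapping_eqI) (simp add: f)
      ultimately show "x \<in> \<phi> ` lattice_points t" by blast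
    qed
  qed
  ultimately show ?thesis unfolding base_polytope_eq by (metis card_image)
qed

text \<open>The vectors e_e - e_j for fixed e form a basis of the hyperplane of coordinate sum 0.
  The room around \<open>center\<close> puts them into the direction space, and the constant
  coordinate sum k bounds that space from above.\<close>

lemma polytope_dim_base_polytope: "polytope_dim (base_polytope bases) = card E - 1"
proof -
  let ?P = "base_polytope bases"
  obtain e where e: "e \<in> E" using card_E_bounds by fastforce
  define D where "D = shift_dir e ` (E - {e})"
  have inj: "inj_on (shift_dir e) (E - {e})"
  proof (rule inj_onI)
    fix i j assume ij: "i \<in> E - {e}" "j \<in> E - {e}" "shift_dir e i = shift_dir e j"
    have "Poly_Mapping.lookup (shift_dir e i) i = Poly_Mapping.lookup (shift_dir e j) i" using ij(3) by simp
    thus "i = j" using ij(1,2) by (auto simp: lookup_shift_dir of_bool_def split: if_splits)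
  qed
  have cD: "card D = card E - 1" using card_image[OF inj] e finite_E by (simp add: D_def)
  have "D \<subseteq> {x - y | x y. x \<in> affine hull ?P \<and> y \<in> affine hull ?P}"
  proof
    fix d assume "d \<in> D"
    then obtain j where j: "j \<in> E" and d: "d = shift_dir e j" by (auto simp: D_def)
    define s where "s = 1 / real (card E)"
    have s: "s > 0" using card_E_bounds by (simp add: s_def)
    have c: "center \<in> affine hull ?P"
      using center_mem_cut_polytope by (auto simp: base_polytope_eq intro: hull_inc)
    have c': "center + s *\<^sub>R d \<in> affine hull ?P"
      using near_center_mem_cut_polytope[OF e j, of s] s by (auto simp: base_polytope_eq d s_def intro: hull_inc)
    \<comment> \<open>The coefficient 1 / s leaves the segment, which an affine hull permits, and
      stretches the short step s d to d.\<close>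
    have "(1 - 1 / s) *\<^sub>R center + (1 / s) *\<^sub>R (center + s *\<^sub>R d) \<in> affine hull ?P"
      using c c' by (intro mem_affine affine_affine_hull) auto
    also have "(1 - 1 / s) *\<^sub>R center + (1 / s) *\<^sub>R (center + s *\<^sub>R d) = center + d"
      using s by (simp add: algebra_simps)
    finally have "center + d \<in> affine hull ?P" .
    moreover have "d = (center + d) - center" by simp
    ultimately show "d \<in> {x - y | x y. x \<in> affine hull ?P \<and> y \<in> affine hull ?P}"
      using c by blast
  qed
  moreover have "{x - y | x y. x \<in> affine hull ?P \<and> y \<in> affine hull ?P} \<subseteq> span D"
  proof safe
    fix x y assume xy: "x \<in> affine hull ?P" "y \<in> affine hull ?P"
    let ?A = "{x. (\<forall>i. i \<notin> E \<longrightarrow> Poly_Mapping.lookup x i = 0) \<and> (\<Sum>i\<in>E. Poly_Mapping.lookup x i) = real k}"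
    have "affine ?A"
      unfolding affine_def
      by (auto simp: sum_lookup_add sum_lookup_scaleR simp del: lookup_scaleR)
        (auto simp: lookup_add distrib_right[symmetric])
    hence "affine hull ?P \<subseteq> ?A"
      by (intro hull_minimal) (auto simp: base_polytope_eq cut_polytope_def)
    hence xA: "x \<in> ?A" and yA: "y \<in> ?A" using xy by auto
    define v where "v = x - y"
    have v0: "Poly_Mapping.lookup v i = 0" if "i \<notin> E" for i
      using xA yA that by (simp add: v_def lookup_minus)
    have "(\<Sum>i\<in>E. Poly_Mapping.lookup v i) = 0"
      using xA yA by (simp add: v_def lookup_minus sum_subtractf)
    hence ve: "Poly_Mapping.lookup v e = - (\<Sum>j\<in>E - {e}. Poly_Mapping.lookup v j)"
      using sum.remove[OF finite_E e, of "Poly_Mapping.lookup v"] by simp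
    have "v = (\<Sum>j\<in>E - {e}. (- Poly_Mapping.lookup v j) *\<^sub>R shift_dir e j)"
    proof (rule poly_mapping_eqI)
      fix l
      have "Poly_Mapping.lookup (\<Sum>j\<in>E - {e}. (- Poly_Mapping.lookup v j) *\<^sub>R shift_dir e j) l =
         (\<Sum>j\<in>E - {e}. (- Poly_Mapping.lookup v j) * (of_bool (l = e) - of_bool (l = j)))"
        by (simp add: lookup_sum lookup_shift_dir)
      also have "\<dots> = Poly_Mapping.lookup v l"
      proof (cases "l = e")
        case True
        have "(\<Sum>j\<in>E - {e}. (- Poly_Mapping.lookup v j) * (of_bool (l = e) - of_bool (l = j))) =
            (\<Sum>j\<in>E - {e}. - Poly_Mapping.lookup v j)"
          using True by (intro sum.cong) auto
        thus ?thesis using ve True by (simp add: sum_negf)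
      next
        case False
        have "(\<Sum>j\<in>E - {e}. (- Poly_Mapping.lookup v j) * (of_bool (l = e) - of_bool (l = j))) =
            (\<Sum>j\<in>E - {e}. if l = j then Poly_Mapping.lookup v j else 0)"
          using False by (intro sum.cong) auto
        also have "\<dots> = Poly_Mapping.lookup v l"
          using finite_E False v0 by (simp add: sum.delta')
        finally show ?thesis .
      qed
      finally show "Poly_Mapping.lookup v l =
        Poly_Mapping.lookup (\<Sum>j\<in>E - {e}. (- Poly_Mapping.lookup v j) *\<^sub>R shift_dir e j) l" ..
    qed
    also have "\<dots> \<in> span D"
      by (intro span_sum span_scale span_base) (auto simp: D_def)
    finally show "x - y \<in> span D" by (simp add: v_def)
  qed
  moreover have "independent D"
  proof (rule independent_if_scalars_zero)
    show "finite D" using finite_E by (simp add: D_def)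
    fix f d assume 0: "(\<Sum>x\<in>D. f x *\<^sub>R x) = 0" and "d \<in> D"
    then obtain j where j: "j \<in> E - {e}" and d: "d = shift_dir e j" by (auto simp: D_def)
    have "0 = Poly_Mapping.lookup (\<Sum>x\<in>D. f x *\<^sub>R x) j" using 0 by simp
    also have "(\<Sum>x\<in>D. f x *\<^sub>R x) = (\<Sum>i\<in>E - {e}. f (shift_dir e i) *\<^sub>R shift_dir e i)"
      unfolding D_def using sum.reindex[OF inj] by (simp add: o_def)
    also have "Poly_Mapping.lookup \<dots> j = (\<Sum>i\<in>E - {e}. if j = i then - f (shift_dir e i) else 0)"
      unfolding lookup_sum using j by (intro sum.cong) (auto simp: lookup_shift_dir)
    also have "\<dots> = - f d" using j finite_E by (simp add: d sum.delta')
    finally show "f d = 0" by simp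
  qed
  ultimately show ?thesis
    unfolding polytope_dim_def using cD by (intro dim_unique)
qed

text \<open>The dilation n^2 u moves the barycentre to the integer point with all coordinates n k u.
  Raising all coordinates but one by arbitrary amounts up to u, with the remaining one balancing the
  sum, gives a full grid of points.\<close>

lemma card_lattice_points_ge:
  "(u + 1) ^ (card E - 1) \<le> card (lattice_points ((card E)\<^sup>2 * u))"
proof -
  define n where "n = card E"
  obtain e where e: "e \<in> E" using card_E_bounds by fastforce
  define D where "D = (E - {e}) \<rightarrow>\<^sub>E {0..u}"
  define \<phi> where "\<phi> g = (\<lambda>i. if i = e then n * k * u - sum g (E - {e}) else if i \<in> E then n * k * u + g i else 0)"
    for g :: "'a \<Rightarrow> nat"
  have n: "k\<^sup>2 + 1 \<le> n" "n > 0" using card_E card_E_bounds by (auto simp: n_def)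
  have k: "3 \<le> k" by (rule k_ge_3)
  have cE: "card (E - {e}) = n - 1" using e finite_E by (simp add: n_def)
  have "card D = (u + 1) ^ (n - 1)"
    unfolding D_def using finite_E by (simp add: card_PiE cE)
  moreover have "inj_on \<phi> D"
  proof (rule inj_onI)
    fix g h assume g: "g \<in> D" and h: "h \<in> D" and eq: "\<phi> g = \<phi> h"
    show "g = h"
    proof (rule PiE_ext[OF g[unfolded D_def] h[unfolded D_def]])
      fix i assume "i \<in> E - {e}"
      thus "g i = h i" using fun_cong[OF eq, of i] by (auto simp: \<phi>_def)
    qed
  qed
  moreover have "\<phi> ` D \<subseteq> lattice_points (n\<^sup>2 * u)"
  proof (rule image_subsetI)
    fix g assume "g \<in> D"
    hence gPiE: "g \<in> (E - {e}) \<rightarrow>\<^sub>E {0..u}" by (simp add: D_def)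
    have g: "g i \<le> u" if "i \<in> E - {e}" for i using PiE_mem[OF gPiE that] by simp
    have "sum g (E - {e}) \<le> (n - 1) * u"
      using sum_bounded_above[of "E - {e}" g u] g cE by simp
    also have "\<dots> \<le> n * k * u"
    proof -
      have "n \<le> n * k" using k by simp
      hence "n - 1 \<le> n * k" by linarith
      thus ?thesis by (rule mult_le_mono1)
    qed
    \<comment> \<open>Thus the truncated subtraction in \<open>\<phi> g e\<close> is a true
      one.\<close>
    finally have sg: "sum g (E - {e}) \<le> n * k * u" .
    have "sum (\<phi> g) E = \<phi> g e + sum (\<phi> g) (E - {e})"
      using e finite_E by (rule sum.remove[rotated])
    also have "sum (\<phi> g) (E - {e}) = (\<Sum>i\<in>E - {e}. n * k * u + g i)"
      by (intro sum.cong) (auto simp: \<phi>_def)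
    also have "\<dots> = (n - 1) * (n * k * u) + sum g (E - {e})"
      by (simp add: sum.distrib cE)
    finally have "sum (\<phi> g) E = n * k * u + (n - 1) * (n * k * u)"
      using sg by (simp add: \<phi>_def)
    also have "\<dots> = k * (n\<^sup>2 * u)"
      using n(2) by (cases n) (auto simp: power2_eq_square algebra_simps)
    finally have tot: "sum (\<phi> g) E = k * (n\<^sup>2 * u)" .
    have le: "\<phi> g i \<le> n * k * u + u" for i
      using g[of i] by (auto simp: \<phi>_def)
    \<comment> \<open>This is where k^2 < n enters: k coordinates, each at most n k u + u, sum to at
      most n^2 u, within every cut.\<close>
    have nk: "k * (n * k + 1) \<le> n\<^sup>2"
    proof -
      have "k \<le> n" using card_E_bounds by (simp add: n_def)
      hence "k * (n * k + 1) \<le> n * (k\<^sup>2 + 1)" by (simp add: power2_eq_square algebra_simps)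
      also have "\<dots> \<le> n * n" using n by (intro mult_left_mono) auto
      finally show ?thesis by (simp add: power2_eq_square)
    qed
    have "1 * (n * k + 1) \<le> k * (n * k + 1)" using k by (intro mult_le_mono1) simp
    hence "n * k + 1 \<le> n\<^sup>2" using nk by simp
    hence "(n * k + 1) * u \<le> n\<^sup>2 * u" by (rule mult_right_mono) simp
    moreover have "(n * k + 1) * u = n * k * u + u" by (simp add: distrib_right)
    ultimately have le2: "\<phi> g i \<le> n\<^sup>2 * u" for i using le[of i] by linarith
    have "sum (\<phi> g) H \<le> (k - 1) * (n\<^sup>2 * u)" if "H \<in> \<H>" for H
    proof -
      have "sum (\<phi> g) H \<le> k * (n * k * u + u)"
        using sum_bounded_above[of H "\<phi> g" "n * k * u + u"] le \<H>_card[OF that] by simp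
      also have "\<dots> = k * (n * k + 1) * u" by (simp add: algebra_simps)
      also have "\<dots> \<le> n\<^sup>2 * u" using nk by (rule mult_right_mono) simp
      also have "\<dots> \<le> (k - 1) * (n\<^sup>2 * u)"
      proof -
        have "1 \<le> k - 1" using k by linarith
        thus ?thesis using mult_le_mono1[of 1 "k - 1" "n\<^sup>2 * u"] by (simp only: mult_1)
      qed
      finally show ?thesis .
    qed
    thus "\<phi> g \<in> lattice_points (n\<^sup>2 * u)"
      using tot le2 e by (auto simp: lattice_points_def compositions_def \<phi>_def)
  qed
  moreover have "finite (lattice_points (n\<^sup>2 * u))"
    unfolding lattice_points_def using finite_compositions[OF finite_E] by simp
  ultimately show ?thesis
    using card_inj_on_le[of \<phi> D] by (simp add: n_def)
qed

lemma degree_ehr_poly: "degree ehr_poly = card E - 1"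
proof (rule antisym[OF degree_ehr_poly_le])
  show "card E - 1 \<le> degree ehr_poly"
  proof (rule degree_ge_of_growth[where c = "(card E)\<^sup>2"])
    fix u :: nat
    have "u ^ (card E - 1) \<le> (u + 1) ^ (card E - 1)" by (intro power_mono) auto
    also have "\<dots> \<le> card (lattice_points ((card E)\<^sup>2 * u))" by (rule card_lattice_points_ge)
    finally have "real (u ^ (card E - 1)) \<le> real (card (lattice_points ((card E)\<^sup>2 * u)))"
      by (simp only: of_nat_le_iff)
    thus "real u ^ (card E - 1) \<le> poly ehr_poly (real ((card E)\<^sup>2 * u))"
      by (simp only: card_lattice_points of_nat_power)
  qed
qed

text \<open>Existence needs the exact degree; uniqueness holds because two candidates agree at all
  natural numbers.\<close>

lemma ehrhart_polynomial_base_polytope: "ehrhart_polynomial (base_polytope bases) = ehr_poly"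
  unfolding ehrhart_polynomial_def
proof (rule the_equality)
  show "degree ehr_poly = polytope_dim (base_polytope bases) \<and>
    (\<forall>t. poly ehr_poly (real t) = real (card ((*\<^sub>R) (real t) ` base_polytope bases \<inter> integer_points)))"
    by (simp add: degree_ehr_poly polytope_dim_base_polytope card_dilation_integer_points card_lattice_points)
next
  fix p assume p: "degree p = polytope_dim (base_polytope bases) \<and>
    (\<forall>t. poly p (real t) = real (card ((*\<^sub>R) (real t) ` base_polytope bases \<inter> integer_points)))"
  have "range real \<subseteq> {x. poly (p - ehr_poly) x = 0}"
    using p by (auto simp: card_dilation_integer_points card_lattice_points)
  moreover have "infinite (range real)"
    by (simp add: finite_image_iff inj_of_nat)
  ultimately have "infinite {x. poly (p - ehr_poly) x = 0}"
    using finite_subset by blast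
  hence "p - ehr_poly = 0" using poly_roots_finite by blast
  thus "p = ehr_poly" by simp
qed

lemma not_ehrhart_positive:
  assumes "coeff ehr_poly 2 \<le> 0"
  shows "\<not> ehrhart_positive (base_polytope bases)"
proof -
  have "2 \<le> polytope_dim (base_polytope bases)"
    using card_E_bounds by (simp add: polytope_dim_base_polytope)
  thus ?thesis
    using assms by (auto simp: ehrhart_positive_def ehrhart_polynomial_base_polytope not_less intro!: exI[of _ 2])
qed

end

subsection \<open>Sparse paving matroids\<close>

context sparse_family
begin

lemma mem_bases_iff: "B \<in> bases \<longleftrightarrow> B \<subseteq> E \<and> card B = k \<and> B \<notin> \<H>"
  by (simp add: bases_def)

lemma neighbours_not_both:
  assumes "B \<in> \<H>" "B' \<in> \<H>" "R \<subseteq> B" "R \<subseteq> B'" "card R = k - 1"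
  shows "B = B'"
proof (rule ccontr)
  assume "B \<noteq> B'"
  hence "card (B \<inter> B') + 2 \<le> k" using assms \<H>_inter by blast
  moreover have "card R \<le> card (B \<inter> B')"
    using assms finite_H by (intro card_mono) auto
  ultimately show False using assms(5) k_ge_3 by linarith
qed

text \<open>By sparsity at most one extension of a (k - 1)-set by one element is a nonbasis.
  Exchange and the independence of small sets rest on this.\<close>

lemma basis_through:
  assumes R: "R \<subseteq> E" "card R = k - 1" and b: "b \<in> E - R" "b' \<in> E - R" "b \<noteq> b'"
  shows "insert b R \<in> bases \<or> insert b' R \<in> bases"
proof -
  have finR: "finite R" using R finite_E finite_subset by blast
  have "insert b R \<noteq> insert b' R" using b by blast
  hence "insert b R \<notin> \<H> \<or> insert b' R \<notin> \<H>"
    using neighbours_not_both[of "insert b R" "insert b' R" R] R by blast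
  moreover have "card (insert b R) = k" "card (insert b' R) = k"
    using b finR R k_ge_3 by auto
  ultimately show ?thesis using R b by (auto simp: mem_bases_iff)
qed

lemma extend_to_basis:
  assumes R: "R \<subseteq> E" "card R = k - 1"
  shows "\<exists>b\<in>E - R. insert b R \<in> bases"
proof -
  have "card (E - R) = card E - (k - 1)"
    using R finite_E by (simp add: card_Diff_subset finite_subset)
  hence "2 \<le> card (E - R)" using card_E_bounds by linarith
  then obtain T where T: "T \<subseteq> E - R" "card T = 2" by (meson obtain_subset_with_card_n)
  then obtain b b' where "b \<in> E - R" "b' \<in> E - R" "b \<noteq> b'" by (auto simp: card_2_iff)
  thus ?thesis using basis_through[OF R] by blast
qed

lemma bases_nonempty: "bases \<noteq> {}"
proof -
  have "k - 1 \<le> card E" using card_E_bounds by linarith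
  then obtain R where "R \<subseteq> E" "card R = k - 1" by (meson obtain_subset_with_card_n)
  thus ?thesis using extend_to_basis by blast
qed

lemma bases_finite: "B \<in> bases \<Longrightarrow> finite B"
  using finite_E finite_subset by (auto simp: mem_bases_iff)

text \<open>If \<open>B - A\<close> has one element, the exchange produces \<open>B\<close> itself;
  otherwise there are two candidates, and \<open>basis_through\<close> makes one of them
  succeed.\<close>

sublocale matroid E bases
proof
  fix A B a assume A: "A \<in> bases" and B: "B \<in> bases" and a: "a \<in> A - B"
  have fin: "finite A" "finite B" using A B bases_finite by auto
  have cards: "card A = k" "card B = k" "A \<subseteq> E" "B \<subseteq> E" using A B by (auto simp: mem_bases_iff)
  let ?R = "A - {a}"
  have R: "?R \<subseteq> E" "card ?R = k - 1" using a fin cards by auto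
  have "card (B - A) = card (A - B)"
    using fin cards card_Diff_subset_Int[of A B] card_Diff_subset_Int[of B A] by (simp add: Int_commute)
  moreover have "card (A - B) > 0" using a fin by (auto simp: card_gt_0_iff)
  ultimately have "card (B - A) > 0" by simp
  then obtain b where b: "b \<in> B - A" by (metis card.empty ex_in_conv less_irrefl)
  show "\<exists>b\<in>B - A. insert b (A - {a}) \<in> bases"
  proof (cases "B - A = {b}")
    case True
    have "card (A - B) = 1" using True \<open>card (B - A) = card (A - B)\<close> by simp
    hence "A - B = {a}" using a by (metis card_1_singletonE singletonD)
    hence "insert b ?R = B" using True by blast
    thus ?thesis using b B by auto
  next
    case False
    then obtain b' where b': "b' \<in> B - A" "b' \<noteq> b" using b by blast
    have "insert b ?R \<in> bases \<or> insert b' ?R \<in> bases"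
      using b b' cards by (intro basis_through[OF R]) auto
    thus ?thesis using b b' by blast
  qed
qed (use finite_E bases_nonempty in \<open>auto simp: mem_bases_iff\<close>)

lemma rank_eq: "rank = k"
  unfolding rank_def
proof (rule the_equality)
  show "\<forall>B\<in>bases. card B = k" by (simp add: mem_bases_iff)
  show "r = k" if "\<forall>B\<in>bases. card B = r" for r
    using that bases_nonempty by (metis all_not_in_conv mem_bases_iff)
qed

lemma indep_card_le:
  assumes "indep I"
  shows "card I \<le> k"
proof -
  obtain B where "B \<in> bases" "I \<subseteq> B" using assms by (auto simp: indep_def)
  thus ?thesis using card_mono[OF bases_finite] mem_bases_iff by metis
qed

lemma indep_of_small:
  assumes "I \<subseteq> E" "card I < k"
  shows "indep I"
proof -
  have fin: "finite I" using assms finite_E finite_subset by blast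
  have "k - 1 \<le> card E" using card_E_bounds by linarith
  moreover have "card I \<le> k - 1" using assms by linarith
  ultimately obtain R where "I \<subseteq> R" "R \<subseteq> E" "card R = k - 1"
    using exists_subset_between[of I "k - 1" E] assms finite_E by blast
  moreover obtain b where "insert b R \<in> bases"
    using extend_to_basis[OF \<open>R \<subseteq> E\<close> \<open>card R = k - 1\<close>] by blast
  ultimately show ?thesis unfolding indep_def by blast
qed

lemma indep_of_card_k:
  assumes "I \<subseteq> E" "card I = k" "I \<notin> \<H>"
  shows "indep I"
  unfolding indep_def using assms mem_bases_iff by blast

lemma circuit_of_\<H>:
  assumes H: "H \<in> \<H>"
  shows "circuit H"
  unfolding circuit_def
proof (intro conjI allI impI)
  show "H \<subseteq> E" using H \<H>_sub by blast
  show "\<not> indep H"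
  proof
    assume "indep H"
    then obtain B where B: "B \<in> bases" "H \<subseteq> B" by (auto simp: indep_def)
    hence "H = B" using bases_finite[OF B(1)] \<H>_card[OF H] by (intro card_subset_eq) (auto simp: mem_bases_iff)
    thus False using B H by (auto simp: mem_bases_iff)
  qed
  fix D assume "D \<subset> H"
  hence "D \<subseteq> E" "card D < k"
    using \<H>_sub[OF H] \<H>_card[OF H] psubset_card_mono[OF finite_H[OF H]] by auto
  thus "indep D" by (rule indep_of_small)
qed

text \<open>Such a set is too large to be independent, while its k-subsets avoid \<H> and are
  therefore bases.\<close>

lemma circuit_of_card_Suc_k:
  assumes S: "S \<subseteq> E" "card S = Suc k" and no: "\<And>H. H \<in> \<H> \<Longrightarrow> \<not> H \<subseteq> S"
  shows "circuit S"
  unfolding circuit_def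
proof (intro conjI allI impI)
  show "S \<subseteq> E" by fact
  show "\<not> indep S" using indep_card_le S(2) by fastforce
  fix D assume D: "D \<subset> S"
  have "finite S" using S finite_E finite_subset by blast
  hence c: "card D < Suc k" using D S psubset_card_mono by metis
  show "indep D"
  proof (cases "card D = k")
    case True
    have "D \<notin> \<H>" using no D by blast
    thus ?thesis using True D S by (intro indep_of_card_k) auto
  next
    case False
    thus ?thesis using c D S by (intro indep_of_small) auto
  qed
qed

text \<open>If no member of \<open>\<H>\<close> contains both \<open>x\<close> and \<open>y\<close>, then one that fits into \<open>R \<union> {x, y, d}\<close>, where
  \<open>R\<close> has \<open>k - 2\<close> elements, is \<open>R \<union> {x, d}\<close> or \<open>R \<union> {y, d}\<close>; sparsity allows each
  for at most one \<open>d\<close>, so three candidates for \<open>d\<close> suffice.\<close>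

lemma connected: "connected_matroid"
  unfolding connected_matroid_def
proof (intro ballI impI)
  fix x y assume xy: "x \<in> E" "y \<in> E" "x \<noteq> y"
  show "\<exists>C. circuit C \<and> x \<in> C \<and> y \<in> C"
  proof (cases "\<exists>H\<in>\<H>. x \<in> H \<and> y \<in> H")
    case True
    thus ?thesis using circuit_of_\<H> by blast
  next
    case False
    have cxy: "card (E - {x, y}) = card E - 2" using xy finite_E by (simp add: card_Diff_subset)
    hence "k - 2 \<le> card (E - {x, y})" using card_E_bounds by linarith
    then obtain R where R: "R \<subseteq> E - {x, y}" "card R = k - 2" by (meson obtain_subset_with_card_n)
    have finR: "finite R" using R finite_E finite_subset by blast
    have "card (E - {x, y} - R) = card E - 2 - (k - 2)" using R cxy finR by (simp add: card_Diff_subset)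
    hence "3 \<le> card (E - {x, y} - R)" using card_E_bounds by linarith
    then obtain T where T: "T \<subseteq> E - {x, y} - R" "card T = 3" by (meson obtain_subset_with_card_n)
    have cR: "card (insert x R) = k - 1" "card (insert y R) = k - 1"
      using R finR k_ge_3 by (auto simp: card_insert_if)
    have uniq: "d = d'" if "insert d (insert z R) \<in> \<H>" "insert d' (insert z R) \<in> \<H>"
      "d \<in> T" "d' \<in> T" "z = x \<or> z = y" for d d' z
    proof -
      have "insert d (insert z R) = insert d' (insert z R)"
        using neighbours_not_both[OF that(1,2), of "insert z R"] cR that(5) by blast
      thus ?thesis using that T by blast
    qed
    have "\<exists>d\<in>T. insert d (insert x R) \<notin> \<H> \<and> insert d (insert y R) \<notin> \<H>"
    proof (rule ccontr)
      assume *: "\<not> ?thesis"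
      obtain a b c where abc: "T = {a, b, c}" "a \<noteq> b" "a \<noteq> c" "b \<noteq> c"
        using T(2) by (auto simp: card_3_iff)
      show False using * abc uniq[of _ x] uniq[of _ y] by (metis insertCI)
    qed
    then obtain d where d: "d \<in> T" "insert d (insert x R) \<notin> \<H>" "insert d (insert y R) \<notin> \<H>" by blast
    define S where "S = insert d (insert x (insert y R))"
    have S: "S \<subseteq> E" using d T R xy by (auto simp: S_def)
    have cS: "card S = Suc k"
    proof -
      have "d \<notin> insert x (insert y R)" "x \<notin> insert y R" "y \<notin> R" using d T R xy by auto
      thus ?thesis using finR R k_ge_3 by (simp add: S_def)
    qed
    have "circuit S"
    proof (rule circuit_of_card_Suc_k[OF S cS])
      fix H assume H: "H \<in> \<H>"
      show "\<not> H \<subseteq> S"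
      proof
        assume HS: "H \<subseteq> S"
        have "x \<notin> H \<or> y \<notin> H" using False H by blast
        hence "H \<subseteq> insert d (insert x R) \<or> H \<subseteq> insert d (insert y R)"
          using HS by (auto simp: S_def)
        moreover have "card (insert d (insert x R)) = k" "card (insert d (insert y R)) = k"
          using cR d T finR R xy k_ge_3 by (auto simp: card_insert_if)
        ultimately have "H = insert d (insert x R) \<or> H = insert d (insert y R)"
          using \<H>_card[OF H] finR card_subset_eq by (metis finite_insert)
        thus False using d H by blast
      qed
    qed
    thus ?thesis by (auto simp: S_def)
  qed
qed

text \<open>The corner bound 1 / ((k - 1) (n - 1)), where n is \<open>card E\<close>, is weakened to
  1 / (k n) for simplicity.\<close>

lemma coeff_2_ehr_poly_le:
  "coeff ehr_poly 2 \<le> 5 * real k ^ 3 * (harm (card E))\<^sup>2 - real (card \<H>) / (real k * real (card E))"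
proof -
  let ?c = "corner_poly (k - 1) (card E - k - 1)"
  have "1 / (real k * real (card E)) \<le> 1 / (real (k - 1) * (real (k - 1) + real (card E - k - 1) + 1))"
    using k_ge_3 card_E_bounds
    by (intro divide_left_mono mult_mono mult_pos_pos) (auto simp: of_nat_diff)
  also have "\<dots> \<le> coeff ?c 2"
    using k_ge_3 by (intro coeff_2_corner_poly_ge) simp
  finally have "real (card \<H>) * (1 / (real k * real (card E))) \<le> real (card \<H>) * coeff ?c 2"
    by (rule mult_left_mono) simp
  moreover have "coeff (hypersimplex_poly (card E) k) 2 \<le> 5 * real k ^ 3 * (harm (card E))\<^sup>2"
    using k_ge_3 card_E_bounds by (intro coeff_2_hypersimplex_poly_le) auto
  ultimately show ?thesis by (simp add: ehr_poly_def)
qed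

end

text \<open>The Graham-Sloane construction: \<open>k\<close>-sets with equal element sum modulo \<open>n\<close> cannot differ in
  a single exchange.\<close>

lemma exists_sparse_family:
  fixes k n :: nat
  assumes k: "3 \<le> k" and n: "k\<^sup>2 < n"
  shows "\<exists>\<H>. sparse_family {1..n} k \<H> \<and> n choose k \<le> n * card \<H>"
proof -
  define A where "A = {H. H \<subseteq> {1..n} \<and> card H = k}"
  define \<H> where "\<H> s = {H \<in> A. \<Sum>H mod n = s}" for s
  have npos: "n > 0" using n by simp
  have finA: "finite A" unfolding A_def by simp
  have "A = (\<Union>s<n. \<H> s)" using npos by (auto simp: \<H>_def)
  hence "card A \<le> (\<Sum>s<n. card (\<H> s))" using card_UN_le[of "{..<n}" \<H>] by simp
  moreover have "card A = n choose k" using n_subsets[of "{1..n}" k] by (simp add: A_def)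
  ultimately have sum: "n choose k \<le> (\<Sum>s<n. card (\<H> s))" by simp
  \<comment> \<open>Some residue class is at least as large as the average over all n
    classes.\<close>
  have "\<exists>s<n. n choose k \<le> n * card (\<H> s)"
  proof (rule ccontr)
    assume "\<not> ?thesis"
    hence less: "n * card (\<H> s) < n choose k" if "s < n" for s using that by (auto simp: not_le)
    have "n * (\<Sum>s<n. card (\<H> s)) < (\<Sum>s<n. n choose k)"
      unfolding sum_distrib_left using less npos by (intro sum_strict_mono) auto
    also have "\<dots> = n * (n choose k)" by simp
    finally show False using sum by simp
  qed
  then obtain s where s: "n choose k \<le> n * card (\<H> s)" by blast
  have "sparse_family {1..n} k (\<H> s)"
  proof
    fix H H' assume H: "H \<in> \<H> s" "H' \<in> \<H> s" "H \<noteq> H'"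
    have fin: "finite H" "finite H'" using H by (auto simp: \<H>_def A_def intro: finite_subset)
    have c: "card H = k" "card H' = k" using H by (auto simp: \<H>_def A_def)
    show "card (H \<inter> H') + 2 \<le> k"
    proof (rule ccontr)
      assume *: "\<not> card (H \<inter> H') + 2 \<le> k"
      have "card (H \<inter> H') \<noteq> k"
        using H c fin by (metis card_subset_eq inf.cobounded1 inf.cobounded2)
      moreover have "card (H \<inter> H') \<le> k" using c fin by (metis card_mono inf.cobounded1)
      ultimately have "card (H \<inter> H') = k - 1" using * by linarith
      hence "card (H - H') = 1" "card (H' - H) = 1"
        using c fin k card_Diff_subset_Int[of H H'] card_Diff_subset_Int[of H' H]
        by (auto simp: Int_commute)
      then obtain a b where ab: "H - H' = {a}" "H' - H = {b}"
        by (auto simp: card_1_singleton_iff)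
      have "\<Sum>H = a + \<Sum>(H \<inter> H')"
        using sum.Int_Diff[OF fin(1), of "\<lambda>x. x" H'] ab by simp
      moreover have "\<Sum>H' = b + \<Sum>(H \<inter> H')"
        using sum.Int_Diff[OF fin(2), of "\<lambda>x. x" H] ab by (simp add: Int_commute)
      ultimately have "(a + \<Sum>(H \<inter> H')) mod n = (b + \<Sum>(H \<inter> H')) mod n"
        using H by (auto simp: \<H>_def)
      hence "a mod n = b mod n"
        using cong_add_rcancel_nat[of a "\<Sum>(H \<inter> H')" b n] by (simp add: cong_def)
      moreover have "a \<in> {1..n}" "b \<in> {1..n}" using ab H by (auto simp: \<H>_def A_def)
      \<comment> \<open>On 1, ..., n residues modulo n are distinct; only n itself has residue 0,
        hence the case split.\<close>
      ultimately have "a = b"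
        by (cases "a = n"; cases "b = n") auto
      thus False using ab by blast
    qed
  qed (use k n in \<open>auto simp: \<H>_def A_def\<close>)
  thus ?thesis using s by blast
qed

text \<open>Since harm n - ln n decreases from 1, harm n is at most 1 + ln n, whose square is o(n).
  Using \<bar>c\<bar> + 1 covers every sign of c and avoids division by zero.\<close>

lemma harm_squared_negligible:
  fixes c d :: real
  assumes "d > 0"
  shows "eventually (\<lambda>n. c * (harm n)\<^sup>2 < d * real n) sequentially"
proof -
  have "(\<lambda>n. (1 + ln (real n))\<^sup>2 / real n) \<longlonglongrightarrow> 0" by real_asymp
  hence "eventually (\<lambda>n. (1 + ln (real n))\<^sup>2 / real n < d / (\<bar>c\<bar> + 1)) sequentially"
    using assms by (intro order_tendstoD) auto
  moreover have "eventually (\<lambda>n. n > (0::nat)) sequentially" by (rule eventually_gt_at_top)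
  ultimately show ?thesis
  proof eventually_elim
    case (elim n)
    have "harm n \<le> 1 + ln (real n)"
      using euler_mascheroni_sequence_decreasing[of 1 n] elim(2) by (simp add: harm_expand)
    hence h: "(harm n)\<^sup>2 \<le> (1 + ln (real n))\<^sup>2" by (intro power_mono harm_nonneg)
    have "(1 + ln (real n))\<^sup>2 * (\<bar>c\<bar> + 1) < d * real n"
      using elim by (simp add: field_simps)
    moreover have "c * (harm n)\<^sup>2 \<le> (\<bar>c\<bar> + 1) * (1 + ln (real n))\<^sup>2"
      using h by (intro mult_mono) auto
    ultimately show ?case by (simp add: mult.commute)
  qed
qed

theorem theorem1p7:
  fixes k :: nat
  assumes "k \<ge> 3"
  shows "\<exists>N::nat. \<forall>n\<ge>N. \<exists>bases :: nat set set.
    matroid {1..n} bases \<and>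
    matroid.connected_matroid {1..n} bases \<and>
    matroid.rank bases = k \<and>
    \<not> ehrhart_positive (base_polytope bases)"
proof -
  \<comment> \<open>The corners remove at least (n choose k) / (k n^2) >= (n / k)^k / (k n^2), and
    n^k >= n^3, which is where k >= 3 enters, leaves n / k^(k + 1).\<close>
  define d where "d = 1 / real k ^ (k + 1)"
  have d: "d > 0" using assms by (simp add: d_def)
  have "eventually (\<lambda>n. 5 * real k ^ 3 * (harm n)\<^sup>2 < d * real n \<and> k\<^sup>2 < n) sequentially"
    using harm_squared_negligible[OF d] eventually_gt_at_top[of "k\<^sup>2"] by (rule eventually_conj)
  then obtain N where N: "\<And>n. n \<ge> N \<Longrightarrow> 5 * real k ^ 3 * (harm n)\<^sup>2 < d * real n" "\<And>n. n \<ge> N \<Longrightarrow> k\<^sup>2 < n"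
    by (auto simp: eventually_sequentially)
  show ?thesis
  proof (rule exI[of _ N], intro allI impI)
    fix n assume n: "N \<le> n"
    obtain \<H> where sf: "sparse_family {1..n} k \<H>" and large: "n choose k \<le> n * card \<H>"
      using exists_sparse_family[OF assms N(2)[OF n]] by blast
    interpret sparse_family "{1..n}" k \<H> by (rule sf)
    have npos: "real n > 0" and kn: "k \<le> n" and kpos: "real k > 0"
      using card_E_bounds assms by auto
    have "d * real n = real n ^ 3 / (real k ^ k * (real k * real n * real n))"
      using npos kpos by (simp add: d_def field_simps power3_eq_cube)
    also have "\<dots> \<le> real n ^ k / (real k ^ k * (real k * real n * real n))"
      using npos kpos assms by (intro divide_right_mono power_increasing) auto
    also have "\<dots> = (real n / real k) ^ k / (real k * real n * real n)"
      by (simp add: power_divide)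
    also have "\<dots> \<le> real (n choose k) / (real k * real n * real n)"
      using binomial_ge_n_over_k_pow_k[OF kn, where 'a = real] by (intro divide_right_mono) auto
    also have "\<dots> \<le> real (n * card \<H>) / (real k * real n * real n)"
      using large by (intro divide_right_mono) (auto simp del: of_nat_mult)
    also have "\<dots> = real (card \<H>) / (real k * real n)"
      using npos by simp
    finally have "coeff ehr_poly 2 \<le> 0"
      using coeff_2_ehr_poly_le N(1)[OF n] by simp
    thus "\<exists>bases. matroid {1..n} bases \<and> matroid.connected_matroid {1..n} bases \<and>
        matroid.rank bases = k \<and> \<not> ehrhart_positive (base_polytope bases)"
      using matroid_axioms connected rank_eq not_ehrhart_positive by blast
  qed
qed

end
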